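(* Let $X$ be a reflexive Banach space and let $H\in F(X)$ be lower semicontinuous. The following assertions are equivalent: (i) $H$ is strongly adequate; (ii) $H^*$ is essentially Fréchet differentiable; (iii) $H$ is essentially firmly subdifferentiable; (iv) $H$ is essentially strongly convex.
   Context: $X$ is a (real) Banach space with topological dual $X^*$ and bidual $X^{**}$; $\langle x,x^*\rangle:=x^*(x)$. $F(X)$ is the class of functions $J:X\to\mathbb{R}\cup\{+\infty\}$ with $\operatorname{dom}J:=\{x\in X: J(x)<\infty\}\neq\emptyset$. For a Banach space $Y$, $\Gamma(Y)$ is the set of lower semicontinuous proper convex functions on $Y$. Conjugate: $H^*(x^* ):=\sup_{x\in X}(\langle x,x^*\rangle-H(x))$ for $x^*\in X^*$. Subdifferential of a function $G$ on a Banach space $Y$: $\partial G(y):=\{y^*\in Y^*: G(v)\ge G(y)+\langle v-y,y^*\rangle\ \forall v\in Y\}$ if $G(y)\in\mathbb{R}$, and $\emptyset$ otherwise; $(\partial G)^{-1}(y^* ):=\{y: y^*\in\partial G(y)\}$. The domain of a set-valued map is the set of points where its value is nonempty. A function $I\in F(X)$ attains a strong minimum over $X$ if it has a minimum point $\bar x\in X$ and every sequence $(x_n)$ with $I(x_n)\to\inf_X I$ converges in norm to $\bar x$. Strongly adequate: $H\in F(X)$, $\operatorname{dom}\partial H^*$ is a nonempty open subset of $X^*$, and $H-x^*$ attains a strong minimum over $X$ for every $x^*\in\operatorname{dom}\partial H^*$. Essentially Fréchet differentiable (function $G$ on a Banach space $Y$): $G\in\Gamma(Y)$, $\operatorname{int}(\operatorname{dom}\partial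 G)\neq\emptyset$, $G$ is Fréchet differentiable at each point of $\operatorname{int}(\operatorname{dom}\partial G)$, and $\|\nabla G(y_n)\|_*\to\infty$ (dual norm) whenever $(y_n)$ is a sequence in $\operatorname{int}(\operatorname{dom}G)$ converging to some boundary point of $\operatorname{dom}G$. $\Gamma_0$ is the set of lower semicontinuous convex functions $\psi:\mathbb{R}_+\to[0,\infty]$ such that $\psi(t)=0\iff t=0$. For $x\in\operatorname{dom}\partial H$, $x^*\in\partial H(x)$ and $\psi\in\Gamma_0$, consider the inequality $$(\star)\qquad H(u)\ge H(x)+\langle u-x,x^*\rangle+\psi(\|u-x\|)\quad\forall u\in X.$$ Essentially firmly subdifferentiable: $H\in F(X)$ is convex and, for every $x\in\operatorname{dom}\partial H$ and every $x^*\in\partial H(x)$, there exists $\psi\in\Gamma_0$ such that $(\star)$ holds. Essentially strictly convex (in the sense of Bauschke–Borwein–Combettes): $H\in\Gamma(X)$, $(\partial H)^{-1}$ is locally bounded on its domain (every point of $\operatorname{dom}(\partial H)^{-1}$ has a neighbourhood $V$ such that $(\partial H)^{-1}(V)$ is bounded), and $H$ is strictly convex on every convex subset of $\operatorname{dom}\partial H$. Essentially strongly convex: $H\in\Gamma(X)$ is essentially strictly convex and for every $x\in\operatorname{dom}\partial H$ there exist $x^*\in\partial H(x)$ and $\psi\in\Gamma_0$ such that $(\star)$ holds. *)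

theory Defs
  imports "HOL-Analysis.Analysis"
begin

definition reflexive_space :: "'a::real_normed_vector itself \<Rightarrow> bool" where
  "reflexive_space _ \<longleftrightarrow>
     (\<forall>\<phi> :: ('a \<Rightarrow>\<^sub>L real) \<Rightarrow>\<^sub>L real. \<exists>x :: 'a. \<forall>f :: 'a \<Rightarrow>\<^sub>L real.
        blinfun_apply \<phi> f = blinfun_apply f x)"

definition eff_dom :: "('a \<Rightarrow> ereal) \<Rightarrow> 'a set" where
  "eff_dom J = {x. J x < \<infinity>}"

definition sv_dom :: "('a \<Rightarrow> 'b set) \<Rightarrow> 'a set" where
  "sv_dom M = {x. M x \<noteq> {}}"

definition sv_inverse :: "('a \<Rightarrow> 'b set) \<Rightarrow> 'b \<Rightarrow> 'a set" where
  "sv_inverse M y = {x. y \<in> M x}"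

definition proper_fun :: "('a \<Rightarrow> ereal) \<Rightarrow> bool" where
  "proper_fun J \<longleftrightarrow> (\<forall>x. J x \<noteq> -\<infinity>) \<and> eff_dom J \<noteq> {}"

definition lsc_on :: "'a::topological_space set \<Rightarrow> ('a \<Rightarrow> ereal) \<Rightarrow> bool" where
  "lsc_on S f \<longleftrightarrow> (\<forall>x\<in>S. f x \<le> Liminf (at x within S) f)"

(* convex_on is restricted to real-valued functions. Since \<infinity> + (-\<infinity>) = \<infinity> in ereal, this is the
   usual notion for functions that do not take the value -\<infinity>, the only ones it is applied to. *)
definition ereal_convex_on :: "'a::real_vector set \<Rightarrow> ('a \<Rightarrow> ereal) \<Rightarrow> bool" where
  "ereal_convex_on S f \<longleftrightarrow> convex S \<and>
     (\<forall>x\<in>S. \<forall>y\<in>S. \<forall>t::real. 0 < t \<and> t < 1 \<longrightarrow>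
        f ((1 - t) *\<^sub>R x + t *\<^sub>R y) \<le> ereal (1 - t) * f x + ereal t * f y)"

definition ereal_strictly_convex_on :: "'a::real_vector set \<Rightarrow> ('a \<Rightarrow> ereal) \<Rightarrow> bool" where
  "ereal_strictly_convex_on S f \<longleftrightarrow> convex S \<and>
     (\<forall>x\<in>S. \<forall>y\<in>S. \<forall>t::real. x \<noteq> y \<and> 0 < t \<and> t < 1 \<longrightarrow>
        f ((1 - t) *\<^sub>R x + t *\<^sub>R y) < ereal (1 - t) * f x + ereal t * f y)"

definition Gamma_fun :: "('a::real_normed_vector \<Rightarrow> ereal) \<Rightarrow> bool" where
  "Gamma_fun G \<longleftrightarrow> proper_fun G \<and> lsc_on UNIV G \<and> ereal_convex_on UNIV G"

definition conjugate :: "('a::real_normed_vector \<Rightarrow> ereal) \<Rightarrow> ('a \<Rightarrow>\<^sub>L real) \<Rightarrow> ereal" where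
  "conjugate H f = (SUP x. ereal (blinfun_apply f x) - H x)"

definition subdiff :: "('a::real_normed_vector \<Rightarrow> ereal) \<Rightarrow> 'a \<Rightarrow> ('a \<Rightarrow>\<^sub>L real) set" where
  "subdiff G y = {g. \<bar>G y\<bar> \<noteq> \<infinity> \<and> (\<forall>v. G v \<ge> G y + ereal (blinfun_apply g (v - y)))}"

definition attains_strong_minimum :: "('a::real_normed_vector \<Rightarrow> ereal) \<Rightarrow> bool" where
  "attains_strong_minimum I \<longleftrightarrow> proper_fun I \<and>
     (\<exists>z. (\<forall>x. I z \<le> I x) \<and>
          (\<forall>u :: nat \<Rightarrow> 'a. (\<lambda>n. I (u n)) \<longlonglongrightarrow> (INF x. I x) \<longrightarrow> u \<longlonglongrightarrow> z))"

definition strongly_adequate :: "('a::real_normed_vector \<Rightarrow> ereal) \<Rightarrow> bool" where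
  "strongly_adequate H \<longleftrightarrow> proper_fun H \<and>
     sv_dom (subdiff (conjugate H)) \<noteq> {} \<and>
     open (sv_dom (subdiff (conjugate H))) \<and>
     (\<forall>f \<in> sv_dom (subdiff (conjugate H)).
        attains_strong_minimum (\<lambda>x. H x - ereal (blinfun_apply f x)))"

(* real_of_ereal sends infinite values to 0, so finiteness near y has to be required explicitly. *)
definition has_frechet_gradient ::
    "('a::real_normed_vector \<Rightarrow> ereal) \<Rightarrow> ('a \<Rightarrow>\<^sub>L real) \<Rightarrow> 'a \<Rightarrow> bool" where
  "has_frechet_gradient G g y \<longleftrightarrow>
     (\<forall>\<^sub>F v in nhds y. \<bar>G v\<bar> \<noteq> \<infinity>) \<and>
     ((\<lambda>v. real_of_ereal (G v)) has_derivative blinfun_apply g) (at y)"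

definition gradient :: "('a::real_normed_vector \<Rightarrow> ereal) \<Rightarrow> 'a \<Rightarrow> ('a \<Rightarrow>\<^sub>L real)" where
  "gradient G y = (THE g. has_frechet_gradient G g y)"

definition ess_frechet_differentiable :: "('a::real_normed_vector \<Rightarrow> ereal) \<Rightarrow> bool" where
  "ess_frechet_differentiable G \<longleftrightarrow> Gamma_fun G \<and>
     interior (sv_dom (subdiff G)) \<noteq> {} \<and>
     (\<forall>y \<in> interior (sv_dom (subdiff G)). \<exists>g. has_frechet_gradient G g y) \<and>
     (\<forall>(u :: nat \<Rightarrow> 'a) z. (\<forall>n. u n \<in> interior (eff_dom G)) \<and> u \<longlonglongrightarrow> z \<and> z \<in> frontier (eff_dom G) \<longrightarrow>
        filterlim (\<lambda>n. norm (gradient G (u n))) at_top sequentially)"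

(* A function on [0,\<infinity>) is encoded by a function on real that is only constrained on {0..}. *)
definition Gamma0 :: "(real \<Rightarrow> ereal) set" where
  "Gamma0 = {\<psi>. (\<forall>t\<ge>0. 0 \<le> \<psi> t) \<and> lsc_on {0..} \<psi> \<and> ereal_convex_on {0..} \<psi> \<and>
                 (\<forall>t\<ge>0. \<psi> t = 0 \<longleftrightarrow> t = 0)}"

definition firm_subgradient_ineq ::
    "('a::real_normed_vector \<Rightarrow> ereal) \<Rightarrow> 'a \<Rightarrow> ('a \<Rightarrow>\<^sub>L real) \<Rightarrow> (real \<Rightarrow> ereal) \<Rightarrow> bool" where
  "firm_subgradient_ineq H x f \<psi> \<longleftrightarrow>
     (\<forall>u. H u \<ge> H x + ereal (blinfun_apply f (u - x)) + \<psi> (norm (u - x)))"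

definition ess_firmly_subdifferentiable :: "('a::real_normed_vector \<Rightarrow> ereal) \<Rightarrow> bool" where
  "ess_firmly_subdifferentiable H \<longleftrightarrow> proper_fun H \<and> ereal_convex_on UNIV H \<and>
     (\<forall>x \<in> sv_dom (subdiff H). \<forall>f \<in> subdiff H x. \<exists>\<psi> \<in> Gamma0. firm_subgradient_ineq H x f \<psi>)"

definition sv_locally_bounded_on_dom ::
    "('a::topological_space \<Rightarrow> 'b::metric_space set) \<Rightarrow> bool" where
  "sv_locally_bounded_on_dom M \<longleftrightarrow>
     (\<forall>y \<in> sv_dom M. \<exists>V. open V \<and> y \<in> V \<and> bounded (\<Union>v\<in>V. M v))"

definition ess_strictly_convex :: "('a::real_normed_vector \<Rightarrow> ereal) \<Rightarrow> bool" where
  "ess_strictly_convex H \<longleftrightarrow> Gamma_fun H \<and>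
     sv_locally_bounded_on_dom (sv_inverse (subdiff H)) \<and>
     (\<forall>C. C \<subseteq> sv_dom (subdiff H) \<and> convex C \<longrightarrow> ereal_strictly_convex_on C H)"

definition ess_strongly_convex :: "('a::real_normed_vector \<Rightarrow> ereal) \<Rightarrow> bool" where
  "ess_strongly_convex H \<longleftrightarrow> Gamma_fun H \<and> ess_strictly_convex H \<and>
     (\<forall>x \<in> sv_dom (subdiff H). \<exists>f \<in> subdiff H x. \<exists>\<psi> \<in> Gamma0. firm_subgradient_ineq H x f \<psi>)"

end

theory Submission
  imports Defs
begin

text \<open>
Throughout, \<open>H\<close> is the given function on \<open>X\<close> and \<open>G\<close> its conjugate on \<open>X\<^sup>*\<close>. All four properties
are compared with one estimate. Say that \<open>H\<close> has firm growth at \<open>x\<close> along \<open>f\<close> if for every \<open>\<epsilon> > 0\<close>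
there is \<open>\<delta> > 0\<close> with \<open>H u \<ge> H x + f (u - x) + \<delta> (|u - x| - \<epsilon>)\<close> for all \<open>u\<close>. Taking the supremum
over \<open>u\<close>, this turns into \<open>G (f + g) \<le> G f + g x + \<epsilon> |g|\<close> for \<open>|g| \<le> \<delta>\<close>, so for a proper lower
semicontinuous \<open>H\<close> firm growth says exactly that \<open>G\<close> is Frechet differentiable at \<open>f\<close> with
gradient \<open>x\<close> (\<open>conjugate_upper_if_firm_growth\<close>, \<open>firm_growth_if_conjugate_upper\<close>). If \<open>G\<close> is
bounded above near \<open>f\<close>, it also amounts to \<open>H - f\<close> attaining a strong minimum at \<open>x\<close>
(\<open>strong_minimum_if_firm_growth\<close>, \<open>firm_growth_if_strong_minimum\<close>). Finally, it means that \<open>f\<close> is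
a subgradient at \<open>x\<close> with a modulus in \<open>Gamma0\<close>, namely the supremum over \<open>\<epsilon>\<close> of the positive
parts of \<open>\<delta> (t - \<epsilon>)\<close> (\<open>Gamma0_modulus_if_firm_growth\<close>).

Hence, reflexivity making each gradient of \<open>G\<close> a point of \<open>X\<close>, (i) and (ii) both mean that the
domain \<open>D\<close> of the subdifferential of \<open>G\<close> is nonempty and that each \<open>f \<in> D\<close> has a point \<open>x\<close> of firm
growth. What has to be added is that \<open>D\<close> is the interior of the domain of \<open>G\<close>. One inclusion
follows from Baire's theorem. In the other, firm growth bounds \<open>G\<close> near \<open>f\<close> at once, while under
(ii) a boundary point of the domain with a subgradient would bound the gradients along a segment
that ends there (\<open>sv_dom_subdiff_if_ess_frechet\<close>).

Property (iii) means that \<open>H\<close> is convex and has firm growth along every subgradient. That (i)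
forces convexity is seen on the biconjugate: by Ekeland's principle every point of its domain is
approximated, together with the value, by points \<open>y\<close> with a subgradient \<open>f\<close>. At such a point the
gradient of \<open>G\<close> at \<open>f\<close> is \<open>y\<close>, so \<open>H\<close> agrees there with the biconjugate, and lower semicontinuity
of \<open>H\<close> does the rest (\<open>convex_if_firm_growth_on_conjugate_dom\<close>). Conversely, for convex \<open>H\<close> in a
reflexive space every \<open>f \<in> D\<close> is a subgradient of \<open>H\<close>.

The step from (iii) to (iv) is a direct estimate. In the other direction firm growth at \<open>x\<close> is
given along one subgradient \<open>f\<^sub>0\<close> only and has to be carried over to each subgradient \<open>f\<close>. Local
boundedness of the subgradients of \<open>G\<close> puts \<open>f\<close> in the interior of \<open>D\<close>
(\<open>interior_if_subdiff_locally_bounded\<close>), and by strict convexity the evaluation at \<open>x\<close> is the only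
subgradient of \<open>G\<close> at \<open>f\<close>; so the derivative of \<open>G\<close> at \<open>f\<close> in the direction \<open>f - f\<^sub>0\<close> is
\<open>(f - f\<^sub>0) x\<close>. Dually, \<open>(f - f\<^sub>0) (u - x)\<close> is controlled by the excess of \<open>H u\<close> over
\<open>H x + f (u - x)\<close>. Added to the growth along \<open>f\<^sub>0\<close>, this gives the growth along \<open>f\<close>.
\<close>

section \<open>The Hahn-Banach theorem\<close>

definition sublinear :: "('a::real_vector \<Rightarrow> real) \<Rightarrow> bool" where
  "sublinear p \<longleftrightarrow> (\<forall>x y. p (x + y) \<le> p x + p y) \<and> (\<forall>t\<ge>0. \<forall>x. p (t *\<^sub>R x) \<le> t * p x)"

lemma sublinear_add: "sublinear p \<Longrightarrow> p (x + y) \<le> p x + p y"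
  by (simp add: sublinear_def)

lemma sublinear_scale_le: "sublinear p \<Longrightarrow> 0 \<le> t \<Longrightarrow> p (t *\<^sub>R x) \<le> t * p x"
  by (simp add: sublinear_def)

lemma sublinear_zero: "sublinear p \<Longrightarrow> p 0 = 0"
  using sublinear_add[of p 0 0] sublinear_scale_le[of p 0 0] by auto

lemma sublinear_minus: "sublinear p \<Longrightarrow> - p (- x) \<le> p x"
  using sublinear_add[of p x "- x"] sublinear_zero[of p] by simp

lemma sublinear_scale:
  assumes "sublinear p" "0 \<le> t"
  shows "p (t *\<^sub>R x) = t * p x"
proof (cases "t = 0")
  case True
  then show ?thesis using sublinear_zero[OF assms(1)] by simp
next
  case False
  with assms have t: "t > 0" by simp
  have "p (inverse t *\<^sub>R (t *\<^sub>R x)) \<le> inverse t * p (t *\<^sub>R x)"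
    using sublinear_scale_le[OF assms(1), of "inverse t" "t *\<^sub>R x"] t by simp
  then have "t * p x \<le> p (t *\<^sub>R x)" using t by (simp add: field_simps)
  with sublinear_scale_le[OF assms] show ?thesis by (simp add: order_antisym)
qed

text \<open>The three infima taken below (of a chain, along a ray, over scaled points of a convex set)
  are covered by one criterion: the family of functions has to be closed, up to decrease, under
  addition and scaling of the arguments.\<close>
lemma sublinear_INF:
  fixes F :: "'i \<Rightarrow> 'a::real_vector \<Rightarrow> real"
  assumes bdd: "\<And>x. bdd_below ((\<lambda>i. F i x) ` I)"
    and zero: "\<exists>i\<in>I. F i 0 \<le> 0"
    and add: "\<And>i j x y. i \<in> I \<Longrightarrow> j \<in> I \<Longrightarrow> \<exists>k\<in>I. F k (x + y) \<le> F i x + F j y"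
    and scale: "\<And>i t x. i \<in> I \<Longrightarrow> 0 < t \<Longrightarrow> \<exists>k\<in>I. F k (t *\<^sub>R x) \<le> t * F i x"
  shows "sublinear (\<lambda>x. INF i\<in>I. F i x)"
proof -
  have ne: "I \<noteq> {}" using zero by auto
  define u where "u = (\<lambda>x. INF i\<in>I. F i x)"
  have lower: "u x \<le> F i x" if "i \<in> I" for i x
    unfolding u_def by (rule cINF_lower[OF bdd that])
  have "u (x + y) \<le> u x + u y" for x y
  proof -
    have "u (x + y) - F i x \<le> u y" if i: "i \<in> I" for i
      unfolding u_def
    proof (rule cINF_greatest[OF ne])
      fix j assume j: "j \<in> I"
      obtain k where "k \<in> I" "F k (x + y) \<le> F i x + F j y" using add[OF i j] by blast
      with lower[of k "x + y"] show "(INF i\<in>I. F i (x + y)) - F i x \<le> F j y" by (simp add: u_def)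
    qed
    then have "u (x + y) - u y \<le> F i x" if "i \<in> I" for i using that by fastforce
    then have "u (x + y) - u y \<le> u x" unfolding u_def by (intro cINF_greatest[OF ne]) auto
    then show ?thesis by simp
  qed
  moreover have "u (t *\<^sub>R x) \<le> t * u x" if t: "0 \<le> t" for t x
  proof (cases "t = 0")
    case True
    obtain i where "i \<in> I" "F i 0 \<le> 0" using zero by blast
    with lower[of i 0] True show ?thesis by simp
  next
    case False
    with t have t: "t > 0" by simp
    have "u (t *\<^sub>R x) / t \<le> F i x" if i: "i \<in> I" for i
    proof -
      obtain k where "k \<in> I" "F k (t *\<^sub>R x) \<le> t * F i x" using scale[OF i t] by blast
      with lower[of k "t *\<^sub>R x"] t show ?thesis by (simp add: field_simps)
    qed
    then have "u (t *\<^sub>R x) / t \<le> u x" unfolding u_def by (intro cINF_greatest[OF ne]) auto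
    with t show ?thesis by (simp add: field_simps)
  qed
  ultimately have "sublinear u" by (simp add: sublinear_def)
  then show ?thesis by (simp add: u_def)
qed

text \<open>Making \<open>q\<close> as small as possible along a direction \<open>x\<close>, by passing to the infimum over
  \<open>t \<ge> 0\<close> of \<open>q (y + t x) - t q x\<close>, gives another sublinear function below \<open>q\<close>. By minimality it
  is \<open>q\<close> itself, which makes \<open>q\<close> superadditive.\<close>
lemma minimal_sublinear_linear:
  fixes q :: "'a::real_vector \<Rightarrow> real"
  assumes q: "sublinear q"
    and minimal: "\<And>q'. sublinear q' \<Longrightarrow> (\<And>x. q' x \<le> q x) \<Longrightarrow> q' = q"
  shows "linear q"
proof -
  have superadd: "q y + q x \<le> q (y + x)" for x y
  proof -
    define F where "F = (\<lambda>t y. q (y + t *\<^sub>R x) - t * q x)"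
    have bdd: "bdd_below ((\<lambda>t. F t y) ` {0..})" for y
    proof (rule bdd_belowI2)
      fix t :: real assume "t \<in> {0..}"
      then have "t * q x = q (t *\<^sub>R x)" using sublinear_scale[OF q] by simp
      also have "\<dots> \<le> q (y + t *\<^sub>R x) + q (- y)"
        using sublinear_add[OF q, of "y + t *\<^sub>R x" "- y"] by simp
      finally show "- q (- y) \<le> F t y" by (simp add: F_def)
    qed
    have "sublinear (\<lambda>y. INF t\<in>{0..}. F t y)"
    proof (rule sublinear_INF[OF bdd])
      show "\<exists>t\<in>{0..}. F t 0 \<le> 0"
        using sublinear_zero[OF q] by (intro bexI[of _ 0]) (auto simp: F_def)
      show "\<exists>k\<in>{0..}. F k (y + z) \<le> F i y + F j z" if "i \<in> {0..}" "j \<in> {0..}" for i j y z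
        using that sublinear_add[OF q, of "y + i *\<^sub>R x" "z + j *\<^sub>R x"]
        by (intro bexI[of _ "i + j"]) (auto simp: F_def algebra_simps)
      show "\<exists>k\<in>{0..}. F k (t *\<^sub>R y) \<le> t * F i y" if "i \<in> {0..}" "0 < t" for i t y
        using that sublinear_scale[OF q, of t "y + i *\<^sub>R x"]
        by (intro bexI[of _ "t * i"]) (auto simp: F_def algebra_simps)
    qed
    moreover have "(INF t\<in>{0..}. F t y) \<le> q y" for y
      using cINF_lower[OF bdd, of 0] by (simp add: F_def)
    ultimately have "(\<lambda>y. INF t\<in>{0..}. F t y) = q" by (rule minimal)
    then have "q y = (INF t\<in>{0..}. F t y)" by (rule fun_cong[symmetric])
    also have "\<dots> \<le> F 1 y" by (rule cINF_lower[OF bdd]) simp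
    finally show ?thesis by (simp add: F_def)
  qed
  then have add: "q (x + y) = q x + q y" for x y
    using sublinear_add[OF q, of x y] by (simp add: order_antisym)
  have neg: "q (- x) = - q x" for x
    using add[of x "- x"] sublinear_zero[OF q] by simp
  have "q (t *\<^sub>R x) = t *\<^sub>R q x" for t x
  proof (cases "0 \<le> t")
    case True
    then show ?thesis using sublinear_scale[OF q] by simp
  next
    case False
    then have "q ((- t) *\<^sub>R x) = (- t) * q x" using sublinear_scale[OF q, of "- t" x] by simp
    then show ?thesis using neg[of "t *\<^sub>R x"] by simp
  qed
  with add show ?thesis by (intro linearI) auto
qed

text \<open>By Zorn's lemma there is a minimal sublinear function below \<open>p\<close>; no extension from subspaces
  is involved.\<close>
theorem Hahn_Banach_sublinear:
  fixes p :: "'a::real_vector \<Rightarrow> real"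
  assumes p: "sublinear p"
  shows "\<exists>f. linear f \<and> (\<forall>x. f x \<le> p x)"
proof -
  define A where "A = {q. sublinear q \<and> (\<forall>x. q x \<le> p x)}"
  define P where "P = (\<lambda>f g :: 'a \<Rightarrow> real. \<forall>x. g x \<le> f x)"
  have "\<exists>m\<in>A. \<forall>a\<in>A. P m a \<longrightarrow> a = m"
  proof (rule predicate_Zorn)
    show "partial_order_on A (relation_of P A)"
      by (rule partial_order_on_relation_ofI)
        (auto simp: P_def fun_eq_iff intro: order_trans order_antisym)
    fix C assume C: "C \<in> Chains (relation_of P A)"
    show "\<exists>u\<in>A. \<forall>a\<in>C. P a u"
    proof (cases "C = {}")
      case True
      then show ?thesis using p by (auto simp: A_def)
    next
      case False
      have CA: "q \<in> A" if "q \<in> C" for q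
        using C that by (auto simp: Chains_def relation_of_def)
      have chain: "P q r \<or> P r q" if "q \<in> C" "r \<in> C" for q r
        using C that by (auto simp: Chains_def relation_of_def)
      have bdd: "bdd_below ((\<lambda>q. q x) ` C)" for x
      proof (rule bdd_belowI2)
        fix q assume "q \<in> C"
        then have "sublinear q" "q (- x) \<le> p (- x)" using CA by (auto simp: A_def)
        then show "- p (- x) \<le> q x" using sublinear_minus[of q x] by linarith
      qed
      let ?u = "\<lambda>x. INF q\<in>C. q x"
      have "sublinear ?u"
      proof (rule sublinear_INF[OF bdd])
        show "\<exists>i\<in>C. i 0 \<le> 0" using False CA sublinear_zero by (fastforce simp: A_def)
        fix i j x y assume ij: "i \<in> C" "j \<in> C"
        have "i (x + y) \<le> i x + i y" "j (x + y) \<le> j x + j y"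
          using CA[OF ij(1)] CA[OF ij(2)] by (auto simp: A_def intro: sublinear_add)
        then show "\<exists>k\<in>C. k (x + y) \<le> i x + j y"
          using chain[OF ij] ij unfolding P_def
          by (meson add_left_mono add_right_mono order_trans)
      next
        fix i x and t :: real assume "i \<in> C" "0 < t"
        then show "\<exists>k\<in>C. k (t *\<^sub>R x) \<le> t * i x"
          using CA sublinear_scale_le[of i t x] by (intro bexI[of _ i]) (auto simp: A_def)
      qed
      moreover have low: "?u x \<le> q x" if "q \<in> C" for q x
        by (rule cINF_lower[OF bdd that])
      moreover have "?u x \<le> p x" for x
        using False CA low by (fastforce simp: A_def intro: order_trans)
      ultimately show ?thesis by (intro bexI[of _ ?u]) (auto simp: A_def P_def)
    qed
  qed
  then obtain m where m: "m \<in> A" and min: "\<And>a. a \<in> A \<Longrightarrow> P m a \<Longrightarrow> a = m" by blast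
  have "linear m"
  proof (rule minimal_sublinear_linear)
    show "sublinear m" using m by (simp add: A_def)
    show "q' = m" if "sublinear q'" "\<And>x. q' x \<le> m x" for q'
      using that m by (intro min) (auto simp: A_def P_def intro: order_trans)
  qed
  with m show ?thesis by (auto simp: A_def)
qed

text \<open>The form in which separation is used. The function that sends \<open>w\<close> to the infimum of
  \<open>t a + L |w - t d|\<close> over \<open>t \<ge> 0\<close> and \<open>(d, a) \<in> E\<close> is sublinear because \<open>E\<close> is convex, and it is
  finite because \<open>E\<close> lies above the cone \<open>- L |d|\<close>. A linear function below it is bounded by \<open>L\<close>
  and lies below \<open>E\<close>.\<close>
theorem Hahn_Banach_convex_set:
  fixes E :: "('a::real_normed_vector \<times> real) set"
  assumes E: "convex E" and L: "0 \<le> L"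
    and above: "\<And>d a. (d, a) \<in> E \<Longrightarrow> - L * norm d \<le> a"
  shows "\<exists>f :: 'a \<Rightarrow>\<^sub>L real. norm f \<le> L \<and> (\<forall>d a. (d, a) \<in> E \<longrightarrow> blinfun_apply f d \<le> a)"
proof (cases "E = {}")
  case True
  then show ?thesis using L by (intro exI[of _ 0]) auto
next
  case False
  define F where "F = (\<lambda>(t :: real, d :: 'a, a :: real) w. t * a + L * norm (w - t *\<^sub>R d))"
  define I where "I = {0::real..} \<times> E"
  have bdd: "bdd_below ((\<lambda>i. F i w) ` I)" for w
  proof (rule bdd_belowI2)
    fix i assume "i \<in> I"
    then obtain t d a where i: "i = (t, d, a)" "0 \<le> t" "(d, a) \<in> E" by (auto simp: I_def)
    have "t * (- L * norm d) \<le> t * a" using above[OF i(3)] i(2) by (intro mult_left_mono)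
    moreover have "L * (t * norm d - norm w) \<le> L * norm (w - t *\<^sub>R d)"
      using L norm_triangle_ineq2[of "t *\<^sub>R d" w] i(2)
      by (intro mult_left_mono) (auto simp: norm_minus_commute)
    ultimately show "- L * norm w \<le> F i w" by (simp add: i F_def algebra_simps)
  qed
  have "sublinear (\<lambda>w. INF i\<in>I. F i w)"
  proof (rule sublinear_INF[OF bdd])
    obtain d a where "(d, a) \<in> E" using False by auto
    then show "\<exists>i\<in>I. F i 0 \<le> 0" by (intro bexI[of _ "(0, d, a)"]) (auto simp: I_def F_def)
  next
    fix i j v w assume ij: "i \<in> I" "j \<in> I"
    then obtain t d a s e b where i: "i = (t, d, a)" "0 \<le> t" "(d, a) \<in> E"
      and j: "j = (s, e, b)" "0 \<le> s" "(e, b) \<in> E" by (auto simp: I_def)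
    have norm_le: "L * norm (v + w - (t *\<^sub>R d + s *\<^sub>R e))
        \<le> L * norm (v - t *\<^sub>R d) + L * norm (w - s *\<^sub>R e)"
      using L norm_triangle_ineq[of "v - t *\<^sub>R d" "w - s *\<^sub>R e"]
      by (metis add_diff_add distrib_left mult_left_mono)
    show "\<exists>k\<in>I. F k (v + w) \<le> F i v + F j w"
    proof (cases "t + s = 0")
      case True
      with i j have "t = 0" "s = 0" by auto
      with norm_le show ?thesis using ij by (intro bexI[of _ i]) (auto simp: i j F_def)
    next
      case False
      with i j have ts: "t + s > 0" by auto
      define c where "c = (t / (t + s)) *\<^sub>R (d, a) + (s / (t + s)) *\<^sub>R (e, b)"
      have "c \<in> E" unfolding c_def
        using i j ts by (intro convexD[OF E]) (auto simp: add_divide_distrib[symmetric])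
      moreover have "(t + s) *\<^sub>R c = (t *\<^sub>R d + s *\<^sub>R e, t * a + s * b)"
        using ts by (simp add: c_def scaleR_add_right distrib_left)
      then have "(t + s) *\<^sub>R fst c = t *\<^sub>R d + s *\<^sub>R e" "(t + s) * snd c = t * a + s * b"
        by (metis fst_conv fst_scaleR, metis snd_conv snd_scaleR real_scaleR_def)
      ultimately show ?thesis using norm_le i j
        by (intro bexI[of _ "(t + s, c)"]) (auto simp: I_def F_def split: prod.splits)
    qed
  next
    fix i w and s :: real assume "i \<in> I" and s: "0 < s"
    then obtain t d a where i: "i = (t, d, a)" "0 \<le> t" "(d, a) \<in> E" by (auto simp: I_def)
    have "norm (s *\<^sub>R w - (s * t) *\<^sub>R d) = s * norm (w - t *\<^sub>R d)"
      using s by (metis norm_scaleR abs_of_pos scaleR_right_diff_distrib scaleR_scaleR)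
    then show "\<exists>k\<in>I. F k (s *\<^sub>R w) \<le> s * F i w"
      using i s by (intro bexI[of _ "(s * t, d, a)"]) (auto simp: I_def F_def algebra_simps)
  qed
  then obtain f where f: "linear f" "\<And>w. f w \<le> (INF i\<in>I. F i w)"
    using Hahn_Banach_sublinear by blast
  have le: "f w \<le> t * a + L * norm (w - t *\<^sub>R d)" if "0 \<le> t" "(d, a) \<in> E" for w t d a
    using f(2)[of w] cINF_lower[OF bdd, of "(t, d, a)" w] that by (auto simp: I_def F_def)
  obtain d0 a0 where "(d0, a0) \<in> E" using False by auto
  then have up: "f w \<le> L * norm w" for w using le[of 0 d0 a0 w] by simp
  have bound: "norm (f w) \<le> L * norm w" for w
    using up[of w] up[of "- w"] linear_neg[OF f(1), of w] by (simp add: abs_le_iff)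
  have "bounded_linear f"
    using f(1) bound by (intro bounded_linear_intro[of f L])
      (auto simp: linear_add linear_scale mult.commute)
  then have app: "blinfun_apply (Blinfun f) = f" by (rule bounded_linear_Blinfun_apply)
  show ?thesis
  proof (intro exI[of _ "Blinfun f"] conjI)
    show "norm (Blinfun f) \<le> L" using bound L by (intro norm_blinfun_bound) (auto simp: app)
    show "\<forall>d a. (d, a) \<in> E \<longrightarrow> blinfun_apply (Blinfun f) d \<le> a"
      using le[of 1 d a d for d a] by (auto simp: app)
  qed
qed

text \<open>Apply separation to the single pair \<open>(- w, - |w|)\<close>.\<close>
lemma norming_functional:
  fixes w :: "'a::real_normed_vector"
  shows "\<exists>g :: 'a \<Rightarrow>\<^sub>L real. norm g \<le> 1 \<and> blinfun_apply g w = norm w"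
proof -
  have "\<exists>g :: 'a \<Rightarrow>\<^sub>L real. norm g \<le> 1 \<and>
      (\<forall>d a. (d, a) \<in> {(- w, - norm w)} \<longrightarrow> blinfun_apply g d \<le> a)"
    by (rule Hahn_Banach_convex_set) auto
  then obtain g :: "'a \<Rightarrow>\<^sub>L real" where g: "norm g \<le> 1" "norm w \<le> blinfun_apply g w"
    by (auto simp: blinfun.minus_right)
  have "blinfun_apply g w \<le> norm g * norm w" using norm_blinfun[of g w] by simp
  also have "\<dots> \<le> norm w" using g(1) by (simp add: mult_left_le_one_le)
  finally show ?thesis using g by (intro exI[of _ g]) auto
qed

section \<open>Ekeland's variational principle\<close>

text \<open>Ekeland's principle for the epigraph instead of the function, so that no extended real
  values occur. A point is dominated by the points of the downward cone of slope \<open>\<epsilon>\<close> below it.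
  Passing repeatedly to a nearly lowest dominated point gives a Cauchy sequence, and its limit
  dominates nothing else.\<close>
theorem Ekeland_set:
  fixes E :: "('a::complete_space \<times> real) set"
  assumes E: "closed E" and below: "\<And>v b. (v, b) \<in> E \<Longrightarrow> m \<le> b"
    and start: "(x0, a0) \<in> E" and eps: "0 < \<epsilon>"
  shows "\<exists>h b. (h, b) \<in> E \<and> b + \<epsilon> * dist h x0 \<le> a0 \<and>
    (\<forall>v b'. (v, b') \<in> E \<longrightarrow> b - \<epsilon> * dist v h \<le> b')"
proof -
  define R where "R = (\<lambda>p q. p \<in> E \<and> snd p + \<epsilon> * dist (fst p) (fst q) \<le> snd (q :: 'a \<times> real))"
  have R_refl: "R p p" if "p \<in> E" for p using that by (simp add: R_def)
  have R_trans: "R p r" if "R p q" "R q r" for p q r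
    using that eps mult_left_mono[OF dist_triangle[of "fst p" "fst r" "fst q"], of \<epsilon>]
    by (auto simp: R_def distrib_left)
  define inf where "inf = (\<lambda>q. INF p\<in>{p. R p q}. snd p)"
  have bdd: "bdd_below (snd ` {p. R p q})" for q
    using below by (intro bdd_belowI2[of _ m]) (auto simp: R_def)
  have step: "\<exists>p. R p q \<and> snd p < inf q + (1/2)^n" if "q \<in> E" for q and n :: nat
  proof -
    have "{p. R p q} \<noteq> {}" using R_refl[OF that] by blast
    moreover have "(INF p\<in>{p. R p q}. snd p) < inf q + (1/2)^n" by (simp add: inf_def)
    ultimately show ?thesis using cINF_less_iff[OF _ bdd, of q "inf q + (1/2)^n"] by blast
  qed
  obtain p where p0: "p 0 = (x0, a0)" and pE: "\<And>n. p n \<in> E"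
    and pS: "\<And>n::nat. R (p (Suc n)) (p n) \<and> snd (p (Suc n)) < inf (p n) + (1/2)^n"
  proof -
    have "\<exists>p. \<forall>n. (p n \<in> E \<and> (n = 0 \<longrightarrow> p n = (x0, a0))) \<and>
        (R (p (Suc n)) (p n) \<and> snd (p (Suc n)) < inf (p n) + (1/2)^n)"
    proof (rule dependent_nat_choice)
      show "\<exists>x. x \<in> E \<and> (0 = (0::nat) \<longrightarrow> x = (x0, a0))" using start by auto
      show "\<exists>y. (y \<in> E \<and> (Suc n = 0 \<longrightarrow> y = (x0, a0))) \<and> R y x \<and> snd y < inf x + (1/2)^n"
        if "x \<in> E \<and> (n = 0 \<longrightarrow> x = (x0, a0))" for x n
        using step[of x n] that by (auto simp: R_def)
    qed
    then show ?thesis using that by blast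
  qed
  have mono: "R (p n) (p k)" if "k \<le> n" for k n
    using that by (induction n rule: dec_induct) (use pE pS R_refl R_trans in blast)+
  have dec: "decseq (\<lambda>n. snd (p n))"
    using mono eps by (fastforce simp: decseq_def R_def intro: order_trans[rotated])
  moreover have "\<And>n. m \<le> snd (p n)" using below pE by (metis prod.collapse)
  ultimately obtain b where b: "(\<lambda>n. snd (p n)) \<longlonglongrightarrow> b"
    using decseq_convergent by metis
  have "Cauchy (\<lambda>n. fst (p n))"
  proof (rule metric_CauchyI)
    fix e :: real assume e: "0 < e"
    have "Cauchy (\<lambda>n. snd (p n))" using b by (rule LIMSEQ_imp_Cauchy)
    then obtain N where N: "\<And>i j. N \<le> i \<Longrightarrow> N \<le> j \<Longrightarrow> dist (snd (p i)) (snd (p j)) < \<epsilon> * e"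
      using metric_CauchyD[of _ "\<epsilon> * e"] e eps by (metis mult_pos_pos)
    have *: "dist (fst (p j)) (fst (p i)) < e" if "N \<le> i" "i \<le> j" for i j
    proof -
      have "\<epsilon> * dist (fst (p j)) (fst (p i)) \<le> snd (p i) - snd (p j)"
        using mono[OF that(2)] by (simp add: R_def)
      also have "\<dots> < \<epsilon> * e" using N[of i j] that by (simp add: dist_real_def)
      finally show ?thesis using eps by simp
    qed
    show "\<exists>M. \<forall>m\<ge>M. \<forall>n\<ge>M. dist (fst (p m)) (fst (p n)) < e"
      by (intro exI[of _ N]) (metis * dist_commute linear)
  qed
  then obtain h where h: "(\<lambda>n. fst (p n)) \<longlonglongrightarrow> h" using Cauchy_convergent convergent_def by metis
  have lim: "p \<longlonglongrightarrow> (h, b)" using tendsto_Pair[OF h b] by simp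
  have hE: "(h, b) \<in> E" using closed_sequentially[OF E] pE lim by blast
  have Rh: "R (h, b) (p k)" for k
  proof -
    have "(\<lambda>n. snd (p n) + \<epsilon> * dist (fst (p n)) (fst (p k))) \<longlonglongrightarrow> b + \<epsilon> * dist h (fst (p k))"
      by (intro tendsto_intros h b)
    moreover have "\<forall>\<^sub>F n in sequentially. snd (p n) + \<epsilon> * dist (fst (p n)) (fst (p k)) \<le> snd (p k)"
      using mono by (intro eventually_sequentiallyI[of k]) (auto simp: R_def)
    ultimately have "b + \<epsilon> * dist h (fst (p k)) \<le> snd (p k)"
      using tendsto_upperbound trivial_limit_sequentially by blast
    then show ?thesis using hE by (simp add: R_def)
  qed
  have "b - \<epsilon> * dist v h \<le> b'" if v: "(v, b') \<in> E" for v b'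
  proof (rule ccontr)
    assume "\<not> ?thesis"
    then have less: "b' + \<epsilon> * dist v h < b" by simp
    then have "R (v, b') (h, b)" using v by (simp add: R_def)
    then have R: "R (v, b') (p k)" for k using Rh R_trans by blast
    have "snd (p (Suc k)) - (1/2)^k \<le> b'" for k
      using cINF_lower[OF bdd, of "(v, b')" "p k"] R[of k] pS[of k] by (simp add: inf_def)
    moreover have "(\<lambda>k. snd (p (Suc k)) - (1/2)^k) \<longlonglongrightarrow> b - 0"
      by (intro tendsto_diff LIMSEQ_Suc[OF b] LIMSEQ_power_zero) simp
    ultimately have "b - 0 \<le> b'" using LIMSEQ_le_const2 by blast
    moreover have "0 \<le> \<epsilon> * dist v h" using eps by simp
    ultimately show False using less by simp
  qed
  moreover have "b + \<epsilon> * dist h x0 \<le> a0" using Rh[of 0] by (simp add: R_def p0)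
  ultimately show ?thesis using hE by blast
qed

section \<open>Epigraphs and subgradients\<close>

text \<open>Extended real functions are handled through pairs of a point and a real upper bound of the
  value: convexity and lower semicontinuity become properties of a set in a normed space, and an
  inequality \<open>ereal c \<le> J u\<close> becomes one between real numbers.\<close>
definition epi :: "('a \<Rightarrow> ereal) \<Rightarrow> ('a \<times> real) set" where
  "epi J = {(x, a). J x \<le> ereal a}"

lemma mem_epigraph [simp]: "(x, a) \<in> epi J \<longleftrightarrow> J x \<le> ereal a"
  by (simp add: epi_def)

lemma ereal_le_iff_epigraph: "ereal c \<le> J u \<longleftrightarrow> (\<forall>a. J u \<le> ereal a \<longrightarrow> c \<le> a)"
proof (cases "J u")
  case MInf
  then show ?thesis by (auto intro!: exI[of _ "c - 1"])
qed auto

lemma mem_eff_dom_iff: "x \<in> eff_dom J \<longleftrightarrow> (\<exists>a. J x \<le> ereal a)"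
  by (cases "J x") (auto simp: eff_dom_def)

lemma closed_epigraph_iff_lsc: "closed (epi J) \<longleftrightarrow> lsc_on UNIV J"
proof
  assume closed: "closed (epi J)"
  show "lsc_on UNIV J"
    unfolding lsc_on_def le_Liminf_iff
  proof (intro ballI allI impI)
    fix x y assume "y < J x"
    then obtain c where c: "y < ereal c" "ereal c < J x" using ereal_dense2 by blast
    have "open (- epi J)" "(x, c) \<in> - epi J" using closed c by auto
    then obtain A B where AB: "open A" "open B" "(x, c) \<in> A \<times> B" "A \<times> B \<subseteq> - epi J"
      by (rule open_prod_elim)
    have "y < J z" if "z \<in> A" for z
    proof -
      have "(z, c) \<in> - epi J" using that AB by blast
      then show ?thesis using c by auto
    qed
    then show "\<forall>\<^sub>F z in at x. y < J z"
      using AB by (auto simp: eventually_at_topological)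
  qed
next
  assume lsc: "lsc_on UNIV J"
  have "\<exists>T. open T \<and> p \<in> T \<and> T \<subseteq> - epi J" if "p \<in> - epi J" for p
  proof -
    from that obtain x a where p: "p = (x, a)" "ereal a < J x" by (cases p) auto
    then obtain c where c: "ereal a < ereal c" "ereal c < J x" using ereal_dense2 by blast
    have "\<forall>\<^sub>F z in at x. ereal c < J z"
      using lsc c by (auto simp: lsc_on_def le_Liminf_iff)
    then obtain S where S: "open S" "x \<in> S" "\<forall>z\<in>S. z \<noteq> x \<longrightarrow> ereal c < J z"
      by (auto simp: eventually_at_topological)
    have "S \<times> {..<c} \<subseteq> - epi J"
    proof
      fix q assume "q \<in> S \<times> {..<c}"
      then obtain z b where q: "q = (z, b)" "z \<in> S" "b < c" by auto
      then have "ereal b < ereal c" "ereal c < J z" using S(3) c by (cases "z = x"; simp)+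
      then have "ereal b < J z" by (rule less_trans)
      then show "q \<in> - epi J" using q by simp
    qed
    then show ?thesis
      using S c p by (intro exI[of _ "S \<times> {..<c}"]) (auto intro: open_Times)
  qed
  then have "open (- epi J)" by (subst open_subopen) blast
  then show "closed (epi J)" by (simp add: closed_def)
qed

lemma convex_epigraph_if_convex:
  assumes "ereal_convex_on UNIV J"
  shows "convex (epi J)"
  unfolding convex_alt
proof (intro ballI allI impI)
  fix p q and t :: real
  assume "p \<in> epi J" "q \<in> epi J" and t: "0 \<le> t \<and> t \<le> 1"
  then obtain x a y b where pq: "p = (x, a)" "J x \<le> ereal a" "q = (y, b)" "J y \<le> ereal b"
    by (cases p, cases q) auto
  show "(1 - t) *\<^sub>R p + t *\<^sub>R q \<in> epi J"
  proof (cases "t = 0 \<or> t = 1")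
    case True
    then show ?thesis using pq by auto
  next
    case False
    then have t: "0 < t" "t < 1" using t by auto
    have "J ((1 - t) *\<^sub>R x + t *\<^sub>R y) \<le> ereal (1 - t) * J x + ereal t * J y"
      using assms t unfolding ereal_convex_on_def by blast
    also have "\<dots> \<le> ereal (1 - t) * ereal a + ereal t * ereal b"
      using pq t by (intro add_mono ereal_mult_left_mono) auto
    finally show ?thesis using pq by simp
  qed
qed

lemma convex_if_convex_epigraph:
  assumes "convex (epi J)" and "\<And>x. J x \<noteq> - \<infinity>"
  shows "ereal_convex_on UNIV J"
  unfolding ereal_convex_on_def
proof (intro conjI ballI allI impI)
  fix x y and t :: real assume t: "0 < t \<and> t < 1"
  show "J ((1 - t) *\<^sub>R x + t *\<^sub>R y) \<le> ereal (1 - t) * J x + ereal t * J y"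
  proof (cases "J x = \<infinity> \<or> J y = \<infinity>")
    case True
    then have "ereal (1 - t) * J x + ereal t * J y = \<infinity>"
      using t assms(2)[of x] assms(2)[of y] by (cases "J x"; cases "J y"; simp)
    then show ?thesis by (metis ereal_less_eq(1))
  next
    case False
    then obtain a b where ab: "J x = ereal a" "J y = ereal b"
      using assms(2)[of x] assms(2)[of y] by (cases "J x"; cases "J y") auto
    then have "(x, a) \<in> epi J" "(y, b) \<in> epi J" by auto
    then have "(1 - t) *\<^sub>R (x, a) + t *\<^sub>R (y, b) \<in> epi J"
      using assms(1) t by (intro convexD_alt) auto
    then show ?thesis by (simp add: ab)
  qed
qed simp

lemma Gamma_fun_iff:
  "Gamma_fun J \<longleftrightarrow> proper_fun J \<and> closed (epi J) \<and> convex (epi J)"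
proof -
  have "ereal_convex_on UNIV J \<longleftrightarrow> convex (epi J)" if "proper_fun J"
  proof
    show "convex (epi J)" if "ereal_convex_on UNIV J" using that by (rule convex_epigraph_if_convex)
    show "ereal_convex_on UNIV J" if "convex (epi J)"
      using that \<open>proper_fun J\<close> by (intro convex_if_convex_epigraph) (simp_all add: proper_fun_def)
  qed
  then show ?thesis by (auto simp: Gamma_fun_def closed_epigraph_iff_lsc)
qed

lemma convex_epigraphD:
  assumes "convex (epi J)" "J x \<le> ereal a" "J y \<le> ereal b" "0 \<le> t" "t \<le> 1"
  shows "J ((1 - t) *\<^sub>R x + t *\<^sub>R y) \<le> ereal ((1 - t) * a + t * b)"
proof -
  have "(x, a) \<in> epi J" "(y, b) \<in> epi J" using assms by auto
  then have "(1 - t) *\<^sub>R (x, a) + t *\<^sub>R (y, b) \<in> epi J"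
    by (rule convexD_alt[OF assms(1) _ _ assms(4,5)])
  then show ?thesis by simp
qed

lemma closed_epigraphD:
  assumes "closed (epi J)" "u \<longlonglongrightarrow> x" "a \<longlonglongrightarrow> b" "\<And>n. J (u n) \<le> ereal (a n)"
  shows "J x \<le> ereal b"
proof -
  have "(\<lambda>n. (u n, a n)) \<longlonglongrightarrow> (x, b)" using assms by (intro tendsto_Pair)
  with assms(4) have "(x, b) \<in> epi J"
    by - (rule closed_sequentially[OF assms(1), where f = "\<lambda>n. (u n, a n)" and l = "(x, b)"]; simp)
  then show ?thesis by simp
qed

lemma subdiff_iff:
  "g \<in> subdiff J y \<longleftrightarrow>
     (\<exists>r. J y = ereal r \<and> (\<forall>v a. J v \<le> ereal a \<longrightarrow> r + blinfun_apply g (v - y) \<le> a))"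
proof -
  have "g \<in> subdiff J y \<longleftrightarrow> (\<exists>r. J y = ereal r \<and> (\<forall>v. ereal (r + blinfun_apply g (v - y)) \<le> J v))"
    by (cases "J y") (auto simp: subdiff_def)
  then show ?thesis by (simp only: ereal_le_iff_epigraph)
qed

lemma sv_dom_subdiff_subset: "sv_dom (subdiff J) \<subseteq> eff_dom J"
  by (auto simp: sv_dom_def subdiff_iff eff_dom_def)

text \<open>\<open>Hahn_Banach_convex_set\<close> with the apex of the cone moved to \<open>(y, c)\<close>.\<close>
lemma affine_minorant_above_cone:
  fixes E :: "('a::real_normed_vector \<times> real) set"
  assumes "convex E" "0 \<le> L" and cone: "\<And>v a. (v, a) \<in> E \<Longrightarrow> c - L * norm (v - y) \<le> a"
  shows "\<exists>g :: 'a \<Rightarrow>\<^sub>L real. norm g \<le> L \<and> (\<forall>v a. (v, a) \<in> E \<longrightarrow> c + blinfun_apply g (v - y) \<le> a)"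
proof -
  have "\<exists>g :: 'a \<Rightarrow>\<^sub>L real. norm g \<le> L \<and>
      (\<forall>d a. (d, a) \<in> (\<lambda>p. p - (y, c)) ` E \<longrightarrow> blinfun_apply g d \<le> a)"
  proof (rule Hahn_Banach_convex_set)
    show "convex ((\<lambda>p. p - (y, c)) ` E)" using assms(1) by simp
    show "- L * norm d \<le> a" if "(d, a) \<in> (\<lambda>p. p - (y, c)) ` E" for d a
      using that cone[of "d + y" "a + c"] by auto
  qed (rule assms)
  then obtain g :: "'a \<Rightarrow>\<^sub>L real" where g: "norm g \<le> L"
    and le: "\<And>d a. (d, a) \<in> (\<lambda>p. p - (y, c)) ` E \<Longrightarrow> blinfun_apply g d \<le> a" by blast
  have "c + blinfun_apply g (v - y) \<le> a" if "(v, a) \<in> E" for v a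
    using le[of "v - y" "a - c"] image_eqI[OF _ that, of "(v - y, a - c)" "\<lambda>p. p - (y, c)"] by simp
  with g show ?thesis by blast
qed

text \<open>Unlike subgradients, the inequality in the hypothesis passes directly to limits in \<open>y\<close>.\<close>
lemma subgradient_above_cone:
  fixes J :: "'a::real_normed_vector \<Rightarrow> ereal"
  assumes "convex (epi J)" "J y = ereal r" "0 \<le> L"
    and "\<And>v a. J v \<le> ereal a \<Longrightarrow> r - L * norm (v - y) \<le> a"
  shows "\<exists>g\<in>subdiff J y. norm g \<le> L"
proof -
  have "\<exists>g :: 'a \<Rightarrow>\<^sub>L real. norm g \<le> L \<and> (\<forall>v a. (v, a) \<in> epi J \<longrightarrow> r + blinfun_apply g (v - y) \<le> a)"
    using assms by (intro affine_minorant_above_cone) auto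
  then show ?thesis using assms(2) by (auto simp: subdiff_iff)
qed

section \<open>Interior points of the domain of a convex function\<close>

lemma convex_lower_cone:
  assumes convex: "convex (epi J)" and y: "J y = ereal r" and \<rho>: "0 < \<rho>"
    and bounded: "\<And>v. norm (v - y) \<le> \<rho> \<Longrightarrow> J v \<le> ereal M" and v: "J v \<le> ereal a"
  shows "r - (M - r) / \<rho> * norm (v - y) \<le> a"
proof (cases "v = y")
  case True
  then show ?thesis using y v by simp
next
  case False
  define t where "t = norm (v - y)"
  have t: "t > 0" using False by (simp add: t_def)
  \<comment> \<open>Reflect \<open>v\<close> through \<open>y\<close> onto the sphere of radius \<open>\<rho>\<close>; then \<open>y\<close> lies between \<open>v\<close> and its image.\<close>
  define w where "w = y - (\<rho> / t) *\<^sub>R (v - y)"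
  have "J w \<le> ereal M"
    using t \<rho> by (intro bounded) (simp add: w_def t_def)
  then have "J ((1 - t / (\<rho> + t)) *\<^sub>R v + (t / (\<rho> + t)) *\<^sub>R w)
      \<le> ereal ((1 - t / (\<rho> + t)) * a + t / (\<rho> + t) * M)"
    using t \<rho> by (intro convex_epigraphD[OF convex v]) (auto simp: field_simps)
  moreover have "(1 - t / (\<rho> + t)) *\<^sub>R v + (t / (\<rho> + t)) *\<^sub>R w = y"
  proof -
    have 1: "1 - t / (\<rho> + t) = \<rho> / (\<rho> + t)" "t / (\<rho> + t) * (\<rho> / t) = \<rho> / (\<rho> + t)"
      using t \<rho> by (auto simp: field_simps)
    have "(1 - t / (\<rho> + t)) *\<^sub>R v + (t / (\<rho> + t)) *\<^sub>R w
        = (1 - t / (\<rho> + t)) *\<^sub>R v + (t / (\<rho> + t)) *\<^sub>R y - (t / (\<rho> + t) * (\<rho> / t)) *\<^sub>R (v - y)"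
      by (simp add: w_def scaleR_diff_right)
    also have "\<dots> = (\<rho> / (\<rho> + t) + t / (\<rho> + t)) *\<^sub>R y"
      unfolding 1 by (simp add: scaleR_diff_right scaleR_add_left)
    also have "\<rho> / (\<rho> + t) + t / (\<rho> + t) = 1" using t \<rho> by (simp add: add_divide_distrib[symmetric])
    finally show ?thesis by simp
  qed
  ultimately have "r \<le> (1 - t / (\<rho> + t)) * a + t / (\<rho> + t) * M" using y by simp
  also have "\<dots> = (\<rho> * a + t * M) / (\<rho> + t)"
  proof -
    have "1 - t / (\<rho> + t) = \<rho> / (\<rho> + t)" using t \<rho> by (simp add: field_simps)
    then show ?thesis by (simp add: add_divide_distrib)
  qed
  finally have "r * (\<rho> + t) \<le> \<rho> * a + t * M" using t \<rho> by (simp add: field_simps)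
  then show ?thesis using \<rho> by (simp add: t_def[symmetric] field_simps)
qed

text \<open>A ball around \<open>y\<close> is covered by the closed symmetric sets on which \<open>J\<close> is at most \<open>n\<close> at
  both \<open>y + w\<close> and \<open>y - w\<close>; by Baire's theorem one of them has an interior point.\<close>
theorem convex_lsc_locally_bounded_above:
  fixes J :: "'a::banach \<Rightarrow> ereal"
  assumes closed: "closed (epi J)" and convex: "convex (epi J)"
    and y: "y \<in> interior (eff_dom J)"
  shows "\<exists>\<rho>>0. \<exists>M. \<forall>v. norm (v - y) \<le> \<rho> \<longrightarrow> J v \<le> ereal M"
proof -
  obtain s where s: "s > 0" "ball y s \<subseteq> eff_dom J" using y mem_interior by blast
  define T where "T = (\<lambda>n::nat. {w. J (y + w) \<le> ereal n \<and> J (y - w) \<le> ereal n})"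
  have closedT: "closed (T n)" for n
  proof -
    have "T n = (\<lambda>w. (y + w, real n)) -` epi J \<inter> (\<lambda>w. (y - w, real n)) -` epi J"
      by (auto simp: T_def)
    moreover have "closed ((\<lambda>w. (y + w, real n)) -` epi J)"
      "closed ((\<lambda>w. (y - w, real n)) -` epi J)"
      by (intro closed_vimage closed continuous_intros)+
    ultimately show ?thesis by auto
  qed
  have cover: "\<exists>n. w \<in> T n" if w: "norm w < s" for w
  proof -
    have "y + w \<in> eff_dom J" "y - w \<in> eff_dom J" using s w by (auto simp: dist_norm)
    then obtain a b where "J (y + w) \<le> ereal a" "J (y - w) \<le> ereal b"
      by (auto simp: mem_eff_dom_iff)
    moreover obtain n :: nat where "max a b \<le> real n" using real_arch_simple by blast
    ultimately have "w \<in> T n" by (auto simp: T_def intro: order_trans)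
    then show ?thesis ..
  qed
  have "\<exists>n. interior (T n) \<noteq> {}"
  proof (rule ccontr)
    assume "\<not> ?thesis"
    then have "euclidean closure_of (\<Inter> (range (\<lambda>n. - T n))) = topspace (euclidean :: 'a topology)"
      using closedT
      by (intro Baire_category) (auto simp: closure_complement completely_metrizable_space_euclidean)
    then have "(0 :: 'a) \<in> closure (\<Inter> (range (\<lambda>n. - T n)))" by simp
    then obtain w where "w \<in> (\<Inter> (range (\<lambda>n. - T n)))" "dist w 0 < s"
      using s(1) closure_approachable by blast
    then show False using cover[of w] by auto
  qed
  then obtain n w0 where "w0 \<in> interior (T n)" by blast
  then obtain \<delta> where \<delta>: "\<delta> > 0" "ball w0 \<delta> \<subseteq> T n" using mem_interior by blast
  \<comment> \<open>\<open>T n\<close> is symmetric and convex, so it contains with a ball the centred ball of the same radius.\<close>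
  have "J v \<le> ereal n" if v: "norm (v - y) < \<delta>" for v
  proof -
    define w where "w = v - y"
    have "w0 + w \<in> T n" "w0 - w \<in> T n" using \<delta> v by (auto simp: w_def dist_norm subset_iff norm_minus_commute)
    then have "J (y + (w0 + w)) \<le> ereal n" "J (y - (w0 - w)) \<le> ereal n" by (auto simp: T_def)
    then have "J ((1 - 1/2) *\<^sub>R (y + (w0 + w)) + (1/2) *\<^sub>R (y - (w0 - w))) \<le> ereal ((1 - 1/2) * n + 1/2 * n)"
      by (intro convex_epigraphD[OF convex]) auto
    moreover have "(1 - 1/2) *\<^sub>R (y + (w0 + w)) + (1/2) *\<^sub>R (y - (w0 - w)) = v"
    proof -
      have "(1 - 1/2) *\<^sub>R (y + (w0 + w)) + (1/2) *\<^sub>R (y - (w0 - w)) = (1/2) *\<^sub>R (v + v)"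
        by (simp add: w_def scaleR_add_right[symmetric])
      then show ?thesis by (simp add: scaleR_add_right scaleR_add_left[symmetric])
    qed
    ultimately show ?thesis by simp
  qed
  then show ?thesis using \<delta>(1) by (intro exI[of _ "\<delta> / 2"]) (auto intro!: exI[of _ "real n"])
qed

lemma interior_eff_dom_subset_sv_dom_subdiff:
  fixes J :: "'a::banach \<Rightarrow> ereal"
  assumes J: "Gamma_fun J"
  shows "interior (eff_dom J) \<subseteq> sv_dom (subdiff J)"
proof
  fix y assume y: "y \<in> interior (eff_dom J)"
  have closed: "closed (epi J)" and convex: "convex (epi J)" and "J y \<noteq> - \<infinity>"
    using J by (auto simp: Gamma_fun_iff proper_fun_def)
  moreover have "J y < \<infinity>" using y interior_subset by (auto simp: eff_dom_def)
  ultimately obtain r where r: "J y = ereal r" by (cases "J y") auto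
  obtain \<rho> M where \<rho>: "0 < \<rho>" and M: "\<And>v. norm (v - y) \<le> \<rho> \<Longrightarrow> J v \<le> ereal M"
    using convex_lsc_locally_bounded_above[OF closed convex y] by blast
  have "r \<le> M" using M[of y] r \<rho> by simp
  then have "\<exists>g\<in>subdiff J y. norm g \<le> (M - r) / \<rho>"
    using \<rho> by (intro subgradient_above_cone[OF convex r] convex_lower_cone[OF convex r \<rho> M]) auto
  then show "y \<in> sv_dom (subdiff J)" by (auto simp: sv_dom_def)
qed

section \<open>Affine minorants of convex functions\<close>

text \<open>The part of the Fenchel-Moreau theorem that is needed: the affine minorants of \<open>J\<close> come
  arbitrarily close to \<open>J x\<close>, also when \<open>J x\<close> is infinite.\<close>
lemma convex_lsc_affine_minorant_through:
  fixes J :: "'a::real_normed_vector \<Rightarrow> ereal"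
  assumes J: "Gamma_fun J" and c: "ereal c < J x"
  shows "\<exists>g :: 'a \<Rightarrow>\<^sub>L real. \<forall>v a. J v \<le> ereal a \<longrightarrow> c + blinfun_apply g (v - x) \<le> a"
proof -
  have closed: "closed (epi J)" and convex: "convex (epi J)" and proper: "proper_fun J"
    using J by (auto simp: Gamma_fun_iff)
  have near: "\<exists>\<rho>>0. \<forall>v. norm (v - z) < \<rho> \<longrightarrow> ereal k < J v" if "ereal k < J z" for k z
  proof -
    have "open ((\<lambda>v. (v, k)) -` (- epi J))"
      using closed by (intro open_vimage continuous_intros) auto
    moreover have "z \<in> (\<lambda>v. (v, k)) -` (- epi J)" using that by simp
    ultimately obtain \<rho> where "\<rho> > 0" "ball z \<rho> \<subseteq> (\<lambda>v. (v, k)) -` (- epi J)"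
      using openE by blast
    then show ?thesis
      by (intro exI[of _ \<rho>]) (auto simp: subset_iff dist_norm norm_minus_commute)
  qed
  \<comment> \<open>First, \<open>J\<close> decreases at most linearly.\<close>
  obtain z where "z \<in> eff_dom J" using proper by (auto simp: proper_fun_def)
  moreover have "J z \<noteq> - \<infinity>" using proper by (auto simp: proper_fun_def)
  ultimately obtain r where r: "J z = ereal r" by (cases "J z") (auto simp: eff_dom_def)
  then obtain \<rho> where \<rho>: "0 < \<rho>" and \<rho>_less: "\<And>v. norm (v - z) < \<rho> \<Longrightarrow> ereal (r - 1) < J v"
    using near[of "r - 1" z] by auto
  have linear: "r - 1 - 2 / \<rho> * norm (v - z) \<le> a" if v: "J v \<le> ereal a" for v a
  proof (cases "norm (v - z) < \<rho>")
    case True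
    have "ereal (r - 1) < J v" using \<rho>_less[OF True] .
    then have "r - 1 < a" using v by (metis less_le_trans less_ereal.simps(1))
    moreover have "0 \<le> 2 / \<rho> * norm (v - z)" using \<rho> by simp
    ultimately show ?thesis by linarith
  next
    case False
    define s where "s = \<rho> / (2 * norm (v - z))"
    have pos: "0 < norm (v - z)" using False \<rho> by linarith
    have s: "0 < s" "s \<le> 1" using False \<rho> pos by (auto simp: s_def field_simps)
    have "norm ((1 - s) *\<^sub>R z + s *\<^sub>R v - z) = s * norm (v - z)"
      using s by (simp add: algebra_simps flip: scaleR_diff_right)
    also have "\<dots> < \<rho>" using pos \<rho> by (simp add: s_def)
    finally have "ereal (r - 1) < J ((1 - s) *\<^sub>R z + s *\<^sub>R v)" by (rule \<rho>_less)
    also have "\<dots> \<le> ereal ((1 - s) * r + s * a)"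
      using r v s by (intro convex_epigraphD[OF convex]) auto
    finally have "- 1 < s * (a - r)" by (simp add: algebra_simps)
    then have "- (1 / s) < a - r" using s by (simp add: field_simps)
    moreover have "1 / s = 2 / \<rho> * norm (v - z)" using pos \<rho> by (simp add: s_def)
    ultimately show ?thesis by linarith
  qed
  \<comment> \<open>Hence a steep enough downward cone with apex \<open>(x, c)\<close> lies below the graph.\<close>
  obtain \<sigma> where \<sigma>: "0 < \<sigma>" and \<sigma>_less: "\<And>v. norm (v - x) < \<sigma> \<Longrightarrow> ereal c < J v"
    using near[OF c] by blast
  define K where "K = \<bar>c\<bar> + \<bar>r\<bar> + 1 + 2 / \<rho> * norm (x - z)"
  have K: "0 \<le> K" using \<rho> by (simp add: K_def)
  have "c - (2 / \<rho> + K / \<sigma>) * norm (v - x) \<le> a" if v: "J v \<le> ereal a" for v a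
  proof (cases "norm (v - x) < \<sigma>")
    case True
    have "ereal c < J v" using \<sigma>_less[OF True] .
    then have "c < a" using v by (metis less_le_trans less_ereal.simps(1))
    moreover have "0 \<le> (2 / \<rho> + K / \<sigma>) * norm (v - x)" using \<rho> \<sigma> K by simp
    ultimately show ?thesis by linarith
  next
    case False
    have "2 / \<rho> * norm (v - z) \<le> 2 / \<rho> * (norm (v - x) + norm (x - z))"
      using \<rho> norm_triangle_ineq[of "v - x" "x - z"] by (intro mult_left_mono) auto
    then have 1: "r - 1 - 2 / \<rho> * norm (v - x) - 2 / \<rho> * norm (x - z) \<le> a"
      using linear[OF v] unfolding distrib_left by linarith
    have "K / \<sigma> * \<sigma> \<le> K / \<sigma> * norm (v - x)" using K \<sigma> False by (intro mult_left_mono) auto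
    then have "K \<le> K / \<sigma> * norm (v - x)" using \<sigma> by simp
    then show ?thesis using 1 unfolding distrib_right K_def by linarith
  qed
  then have "\<exists>g :: 'a \<Rightarrow>\<^sub>L real. norm g \<le> 2 / \<rho> + K / \<sigma> \<and> 
      (\<forall>v a. (v, a) \<in> epi J \<longrightarrow> c + blinfun_apply g (v - x) \<le> a)"
    using \<rho> \<sigma> K by (intro affine_minorant_above_cone[OF convex]) auto
  then show ?thesis by auto
qed

section \<open>Conjugates\<close>

text \<open>The canonical embedding into the bidual, where the subgradients of a conjugate live.\<close>
definition eval_at :: "'a::real_normed_vector \<Rightarrow> ('a \<Rightarrow>\<^sub>L real) \<Rightarrow>\<^sub>L real" where
  "eval_at x = Blinfun (\<lambda>f. blinfun_apply f x)"

lemma eval_at_apply [simp]: "blinfun_apply (eval_at x) f = blinfun_apply f x"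
  unfolding eval_at_def by (simp add: bounded_linear_Blinfun_apply blinfun.bounded_linear_left)

lemma norm_eval_at_le: "norm (eval_at x) \<le> norm x"
  by (rule norm_blinfun_bound) (auto simp: norm_blinfun mult.commute[of "norm x"] simp flip: real_norm_def)

lemma reflexive_spaceE:
  fixes \<phi> :: "('a::real_normed_vector \<Rightarrow>\<^sub>L real) \<Rightarrow>\<^sub>L real"
  assumes "reflexive_space TYPE('a)"
  obtains x where "\<phi> = eval_at x"
proof -
  obtain x :: 'a where "\<forall>f. blinfun_apply \<phi> f = blinfun_apply f x"
    using assms unfolding reflexive_space_def by blast
  then show thesis by (intro that[of x] blinfun_eqI) simp
qed

text \<open>Points above the graph of the conjugate correspond to affine minorants of \<open>J\<close>.\<close>
lemma conjugate_le_iff: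
  "conjugate J f \<le> ereal b \<longleftrightarrow> (\<forall>u a. J u \<le> ereal a \<longrightarrow> blinfun_apply f u - b \<le> a)"
proof -
  have "ereal (blinfun_apply f u) - J u \<le> ereal b \<longleftrightarrow> ereal (blinfun_apply f u - b) \<le> J u" for u
    by (cases "J u") auto
  then show ?thesis by (simp add: conjugate_def SUP_le_iff ereal_le_iff_epigraph)
qed

lemma Fenchel_Young: "conjugate J f \<le> ereal b \<Longrightarrow> J u \<le> ereal a \<Longrightarrow> blinfun_apply f u - b \<le> a"
  by (simp add: conjugate_le_iff)

lemma conjugate_ge: "J u \<le> ereal a \<Longrightarrow> ereal (blinfun_apply f u - a) \<le> conjugate J f"
  unfolding ereal_le_iff_epigraph using Fenchel_Young by fastforce

lemma epi_conjugate:
  fixes J :: "'a::real_normed_vector \<Rightarrow> ereal"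
  shows "epi (conjugate J) = (\<Inter>p\<in>epi J. {q. blinfun_apply (fst q) (fst p) - snd q \<le> snd p})"
proof (rule set_eqI)
  fix q :: "('a \<Rightarrow>\<^sub>L real) \<times> real"
  show "q \<in> epi (conjugate J) \<longleftrightarrow>
      q \<in> (\<Inter>p\<in>epi J. {q. blinfun_apply (fst q) (fst p) - snd q \<le> snd p})"
    by (cases q) (simp only: INT_iff mem_Collect_eq Ball_def split_paired_All mem_epigraph
        conjugate_le_iff fst_conv snd_conv)
qed

lemma closed_epi_conjugate: "closed (epi (conjugate J))"
  unfolding epi_conjugate by (intro closed_INT ballI closed_Collect_le continuous_intros)

lemma convex_epi_conjugate: "convex (epi (conjugate J))"
proof (rule convexI)
  fix p q and s t :: real
  assume "p \<in> epi (conjugate J)" "q \<in> epi (conjugate J)" and st: "0 \<le> s" "0 \<le> t" "s + t = 1"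
  then obtain f b g c where pq: "p = (f, b)" "q = (g, c)"
    and fg: "conjugate J f \<le> ereal b" "conjugate J g \<le> ereal c" by (cases p, cases q) auto
  have "conjugate J (s *\<^sub>R f + t *\<^sub>R g) \<le> ereal (s * b + t * c)"
    unfolding conjugate_le_iff
  proof (intro allI impI)
    fix u a assume "J u \<le> ereal a"
    then have "s * (blinfun_apply f u - b) \<le> s * a" "t * (blinfun_apply g u - c) \<le> t * a"
      using Fenchel_Young[OF fg(1)] Fenchel_Young[OF fg(2)] st by (auto intro!: mult_left_mono)
    moreover have "s * a + t * a = a" using st by (simp flip: distrib_right)
    ultimately show "blinfun_apply (s *\<^sub>R f + t *\<^sub>R g) u - (s * b + t * c) \<le> a"
      by (simp add: blinfun.add_left blinfun.scaleR_left algebra_simps)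
  qed
  then show "s *\<^sub>R p + t *\<^sub>R q \<in> epi (conjugate J)" by (simp add: pq)
qed

lemma proper_fun_finite_point:
  assumes "proper_fun J"
  obtains u a where "J u = ereal a"
proof -
  obtain u where u: "u \<in> eff_dom J" using assms by (auto simp: proper_fun_def)
  moreover have "J u \<noteq> - \<infinity>" using assms by (auto simp: proper_fun_def)
  ultimately show thesis using that by (cases "J u") (auto simp: eff_dom_def)
qed

lemma conjugate_not_MInf:
  assumes "proper_fun J"
  shows "conjugate J f \<noteq> - \<infinity>"
proof -
  obtain u a where "J u = ereal a" using proper_fun_finite_point[OF assms] .
  then have "ereal (blinfun_apply f u - a) \<le> conjugate J f" by (intro conjugate_ge) simp
  then show ?thesis by auto
qed

lemma conjugate_finite:
  assumes "proper_fun J" "f \<in> eff_dom (conjugate J)"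
  obtains s where "conjugate J f = ereal s"
  using conjugate_not_MInf[OF assms(1), of f] assms(2) by (cases "conjugate J f") (auto simp: eff_dom_def)

lemma Gamma_fun_conjugate:
  assumes "proper_fun J" "eff_dom (conjugate J) \<noteq> {}"
  shows "Gamma_fun (conjugate J)"
  using assms conjugate_not_MInf[OF assms(1)] closed_epi_conjugate convex_epi_conjugate
  unfolding Gamma_fun_iff proper_fun_def by blast

lemma conjugate_eq_if_subdiff:
  assumes "f \<in> subdiff J x" "J x = ereal r"
  shows "conjugate J f = ereal (blinfun_apply f x - r)"
proof (rule antisym)
  show "conjugate J f \<le> ereal (blinfun_apply f x - r)"
    using assms by (fastforce simp: subdiff_iff conjugate_le_iff blinfun.diff_right)
  show "ereal (blinfun_apply f x - r) \<le> conjugate J f"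
    using assms by (intro conjugate_ge) simp
qed

lemma subdiff_if_conjugate_le:
  assumes "J x = ereal r" "conjugate J f \<le> ereal (blinfun_apply f x - r)"
  shows "f \<in> subdiff J x"
  using assms Fenchel_Young[OF assms(2)] by (fastforce simp: subdiff_iff blinfun.diff_right)

lemma subdiff_conjugate_if_subdiff:
  assumes "f \<in> subdiff J x"
  shows "eval_at x \<in> subdiff (conjugate J) f"
proof -
  obtain r where r: "J x = ereal r" using assms by (auto simp: subdiff_iff)
  have "blinfun_apply f x - r + blinfun_apply (eval_at x) (g - f) \<le> b"
    if "conjugate J g \<le> ereal b" for g b
    using Fenchel_Young[OF that, of x r] r by (simp add: blinfun.diff_left)
  then show ?thesis using conjugate_eq_if_subdiff[OF assms r] by (auto simp: subdiff_iff)
qed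

section \<open>Firm growth and differentiability of the conjugate\<close>

text \<open>The estimate to which all four properties are reduced. For \<open>|u - x| \<le> \<epsilon>\<close> the added term is
  not positive, so it has effect only away from \<open>x\<close>; there it demands linear growth.\<close>
definition firm_growth ::
    "('a::real_normed_vector \<Rightarrow> ereal) \<Rightarrow> 'a \<Rightarrow> ('a \<Rightarrow>\<^sub>L real) \<Rightarrow> bool" where
  "firm_growth J x f \<longleftrightarrow> (\<exists>r. J x = ereal r \<and>
     (\<forall>\<epsilon>>0. \<exists>\<delta>>0. \<forall>u a. J u \<le> ereal a \<longrightarrow>
        r + blinfun_apply f (u - x) + \<delta> * (norm (u - x) - \<epsilon>) \<le> a))"

lemma firm_growthD:
  assumes "firm_growth J x f" "J x = ereal r" "0 < \<epsilon>"
  obtains \<delta> where "0 < \<delta>"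
    "\<And>u a. J u \<le> ereal a \<Longrightarrow> r + blinfun_apply f (u - x) + \<delta> * (norm (u - x) - \<epsilon>) \<le> a"
  using assms unfolding firm_growth_def by (metis ereal.inject)

lemma firm_growth_finite:
  assumes "firm_growth J x f"
  obtains r where "J x = ereal r"
  using assms unfolding firm_growth_def by blast

text \<open>Choose \<open>\<epsilon> = |u - x|\<close>.\<close>
lemma subdiff_if_firm_growth:
  assumes firm: "firm_growth J x f"
  shows "f \<in> subdiff J x"
proof -
  obtain r where r: "J x = ereal r" using firm_growth_finite[OF firm] .
  have "r + blinfun_apply f (u - x) \<le> a" if u: "J u \<le> ereal a" for u a
  proof (cases "u = x")
    case True
    then show ?thesis using u r by (simp add: blinfun.zero_right)
  next
    case False
    then have "0 < norm (u - x)" by simp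
    then obtain \<delta> where
      "\<And>u' a. J u' \<le> ereal a \<Longrightarrow> r + blinfun_apply f (u' - x) + \<delta> * (norm (u' - x) - norm (u - x)) \<le> a"
      using firm_growthD[OF firm r] by metis
    from this[OF u] show ?thesis by simp
  qed
  then show ?thesis using r by (auto simp: subdiff_iff)
qed

text \<open>For \<open>|g| \<le> \<delta>\<close> the gain \<open>g (u - x)\<close> is at most \<open>\<epsilon> |g|\<close> near \<open>x\<close>, and further away it exceeds
  the growth of \<open>J\<close> by at most that much.\<close>
lemma conjugate_upper_if_firm_growth:
  assumes firm: "firm_growth J x f" and r: "J x = ereal r" and \<epsilon>: "0 < \<epsilon>"
  obtains \<delta> where "0 < \<delta>"
    "\<And>g. norm g \<le> \<delta> \<Longrightarrow>
       conjugate J (f + g) \<le> ereal (blinfun_apply f x - r + blinfun_apply g x + \<epsilon> * norm g)"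
proof -
  obtain \<delta> where \<delta>: "0 < \<delta>"
    and growth: "\<And>u a. J u \<le> ereal a \<Longrightarrow> r + blinfun_apply f (u - x) + \<delta> * (norm (u - x) - \<epsilon>) \<le> a"
    using firm_growthD[OF firm r \<epsilon>] by metis
  have sub: "\<And>u a. J u \<le> ereal a \<Longrightarrow> r + blinfun_apply f (u - x) \<le> a"
    using subdiff_if_firm_growth[OF firm] r by (auto simp: subdiff_iff)
  have "conjugate J (f + g) \<le> ereal (blinfun_apply f x - r + blinfun_apply g x + \<epsilon> * norm g)"
    if g: "norm g \<le> \<delta>" for g
    unfolding conjugate_le_iff
  proof (intro allI impI)
    fix u a assume u: "J u \<le> ereal a"
    have "r + blinfun_apply f (u - x) + norm g * (norm (u - x) - \<epsilon>) \<le> a"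
    proof (cases "\<epsilon> \<le> norm (u - x)")
      case True
      then have "norm g * (norm (u - x) - \<epsilon>) \<le> \<delta> * (norm (u - x) - \<epsilon>)"
        using g by (intro mult_right_mono) auto
      then show ?thesis using growth[OF u] by simp
    next
      case False
      then have "norm g * (norm (u - x) - \<epsilon>) \<le> 0" by (intro mult_nonneg_nonpos) auto
      then show ?thesis using sub[OF u] by simp
    qed
    moreover have "blinfun_apply g (u - x) \<le> norm g * norm (u - x)"
      using norm_blinfun[of g "u - x"] by simp
    ultimately show "blinfun_apply (f + g) u
        - (blinfun_apply f x - r + blinfun_apply g x + \<epsilon> * norm g) \<le> a"
      by (simp add: blinfun.add_left blinfun.diff_right algebra_simps)
  qed
  then show thesis using that \<delta> by blast
qed

text \<open>Insert \<open>g\<close> of norm \<open>\<delta>\<close> that attains the norm at \<open>u - x\<close>. The growth found in this way makes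
  every maximising sequence of \<open>f - J\<close> converge to \<open>x\<close>, and lower semicontinuity shows that the
  supremum is attained there.\<close>
lemma firm_growth_if_conjugate_upper:
  assumes closed: "closed (epi J)" and s: "conjugate J f = ereal s"
    and upper: "\<And>\<epsilon>. 0 < \<epsilon> \<Longrightarrow> \<exists>\<delta>>0. \<forall>g. norm g \<le> \<delta> \<longrightarrow>
      conjugate J (f + g) \<le> ereal (s + blinfun_apply g x + \<epsilon> * norm g)"
  shows "firm_growth J x f"
proof -
  have growth: "\<exists>\<delta>>0. \<forall>u a. J u \<le> ereal a \<longrightarrow>
      blinfun_apply f u - s + \<delta> * (norm (u - x) - \<epsilon>) \<le> a" if \<epsilon>: "0 < \<epsilon>" for \<epsilon>
  proof -
    obtain \<delta> where \<delta>: "0 < \<delta>" and up: "\<And>g. norm g \<le> \<delta> \<Longrightarrow>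
      conjugate J (f + g) \<le> ereal (s + blinfun_apply g x + \<epsilon> * norm g)" using upper[OF \<epsilon>] by blast
    have "blinfun_apply f u - s + \<delta> * (norm (u - x) - \<epsilon>) \<le> a" if u: "J u \<le> ereal a" for u a
    proof -
      obtain h :: "'a \<Rightarrow>\<^sub>L real" where h: "norm h \<le> 1" "blinfun_apply h (u - x) = norm (u - x)"
        using norming_functional by blast
      define g where "g = \<delta> *\<^sub>R h"
      have g: "norm g \<le> \<delta>" "blinfun_apply g (u - x) = \<delta> * norm (u - x)"
        using h \<delta> by (auto simp: g_def blinfun.scaleR_left)
      have "blinfun_apply (f + g) u - (s + blinfun_apply g x + \<epsilon> * norm g) \<le> a"
        using Fenchel_Young[OF up[OF g(1)] u] .
      moreover have "\<epsilon> * norm g \<le> \<epsilon> * \<delta>" using \<epsilon> g by (intro mult_left_mono) auto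
      ultimately show ?thesis
        using g(2) by (simp add: blinfun.add_left blinfun.diff_right algebra_simps)
    qed
    then show ?thesis using \<delta> by blast
  qed
  have "J x \<le> ereal (blinfun_apply f x - s)"
  proof -
    \<comment> \<open>A maximising sequence of \<open>f - J\<close>.\<close>
    have "\<exists>u. J u \<le> ereal (blinfun_apply f u - s + inverse (Suc n))" for n
    proof -
      have "\<not> conjugate J f \<le> ereal (s - inverse (Suc n))" by (simp add: s)
      then obtain u a where "J u \<le> ereal a" "\<not> blinfun_apply f u - (s - inverse (Suc n)) \<le> a"
        unfolding conjugate_le_iff by blast
      then have "J u \<le> ereal (blinfun_apply f u - s + inverse (Suc n))"
        by (intro order_trans[OF \<open>J u \<le> ereal a\<close>]) simp
      then show ?thesis ..
    qed
    then obtain u where u: "\<And>n. J (u n) \<le> ereal (blinfun_apply f (u n) - s + inverse (Suc n))" by metis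
    have "u \<longlonglongrightarrow> x"
      unfolding tendsto_iff
    proof (intro allI impI)
      fix e :: real assume e: "0 < e"
      then obtain \<delta> where \<delta>: "0 < \<delta>" and gr: "\<And>u a. J u \<le> ereal a \<Longrightarrow>
          blinfun_apply f u - s + \<delta> * (norm (u - x) - e / 2) \<le> a" using growth[of "e / 2"] by auto
      have "\<forall>\<^sub>F n in sequentially. inverse (real (Suc n)) < \<delta> * (e / 2)"
        using \<delta> e by (intro order_tendstoD(2)[OF LIMSEQ_inverse_real_of_nat]) simp
      then show "\<forall>\<^sub>F n in sequentially. dist (u n) x < e"
      proof eventually_elim
        case (elim n)
        with gr[OF u[of n]] have "\<delta> * (norm (u n - x) - e / 2) < \<delta> * (e / 2)" by simp
        then show ?case using \<delta> by (simp add: dist_norm)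
      qed
    qed
    moreover have "(\<lambda>n. blinfun_apply f (u n) - s + inverse (Suc n)) \<longlonglongrightarrow> blinfun_apply f x - s + 0"
      by (intro tendsto_intros LIMSEQ_inverse_real_of_nat \<open>u \<longlonglongrightarrow> x\<close>)
    ultimately show ?thesis using closed_epigraphD[OF closed _ _ u] by fastforce
  qed
  moreover have "ereal (blinfun_apply f x - s) \<le> J x"
    using Fenchel_Young[of J f s x] s by (simp add: ereal_le_iff_epigraph)
  ultimately have "J x = ereal (blinfun_apply f x - s)" by (rule antisym)
  moreover have eq: "blinfun_apply f x - s + blinfun_apply f (u - x) = blinfun_apply f u - s" for u
    by (simp add: blinfun.diff_right)
  moreover have "\<forall>\<epsilon>>0. \<exists>\<delta>>0. \<forall>u a. J u \<le> ereal a \<longrightarrow>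
      blinfun_apply f x - s + blinfun_apply f (u - x) + \<delta> * (norm (u - x) - \<epsilon>) \<le> a"
    unfolding eq using growth by blast
  ultimately show ?thesis unfolding firm_growth_def by blast
qed

lemma firm_growth_interior:
  assumes firm: "firm_growth J x f"
  shows "f \<in> interior (eff_dom (conjugate J))"
proof -
  obtain r where r: "J x = ereal r" using firm_growth_finite[OF firm] .
  obtain \<delta> where \<delta>: "0 < \<delta>" and up: "\<And>g. norm g \<le> \<delta> \<Longrightarrow>
       conjugate J (f + g) \<le> ereal (blinfun_apply f x - r + blinfun_apply g x + 1 * norm g)"
    using conjugate_upper_if_firm_growth[OF firm r zero_less_one] by metis
  have "ball f \<delta> \<subseteq> eff_dom (conjugate J)"
  proof
    fix h assume "h \<in> ball f \<delta>"
    then show "h \<in> eff_dom (conjugate J)"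
      using up[of "h - f"] by (auto simp: mem_eff_dom_iff dist_norm norm_minus_commute)
  qed
  then show ?thesis using \<delta> mem_interior by blast
qed

lemma conjugate_frechet_if_firm_growth:
  assumes proper: "proper_fun J" and firm: "firm_growth J x f"
  shows "has_frechet_gradient (conjugate J) (eval_at x) f"
  unfolding has_frechet_gradient_def has_derivative_at_alt
proof (intro conjI allI impI)
  have "\<forall>\<^sub>F v in nhds f. v \<in> interior (eff_dom (conjugate J))"
    using firm_growth_interior[OF firm] by (intro eventually_nhds_in_open) auto
  then show "\<forall>\<^sub>F v in nhds f. \<bar>conjugate J v\<bar> \<noteq> \<infinity>"
  proof eventually_elim
    case (elim v)
    then obtain s where "conjugate J v = ereal s"
      using conjugate_finite[OF proper] interior_subset by blast
    then show ?case by simp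
  qed
  show "bounded_linear (blinfun_apply (eval_at x))" by (rule blinfun.bounded_linear_right)
  fix e :: real assume e: "0 < e"
  obtain r where r: "J x = ereal r" using firm_growth_finite[OF firm] .
  obtain \<delta> where \<delta>: "0 < \<delta>" and up: "\<And>g. norm g \<le> \<delta> \<Longrightarrow>
       conjugate J (f + g) \<le> ereal (blinfun_apply f x - r + blinfun_apply g x + e * norm g)"
    using conjugate_upper_if_firm_growth[OF firm r e] by metis
  have f: "conjugate J f = ereal (blinfun_apply f x - r)"
    by (rule conjugate_eq_if_subdiff[OF subdiff_if_firm_growth[OF firm] r])
  show "\<exists>d>0. \<forall>y. norm (y - f) < d \<longrightarrow>
      norm (real_of_ereal (conjugate J y) - real_of_ereal (conjugate J f) - blinfun_apply (eval_at x) (y - f))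
        \<le> e * norm (y - f)"
  proof (intro exI[of _ \<delta>] conjI \<delta> allI impI)
    fix y assume y: "norm (y - f) < \<delta>"
    have 1: "conjugate J y \<le> ereal (blinfun_apply f x - r + blinfun_apply (y - f) x + e * norm (y - f))"
      using up[of "y - f"] y by simp
    have 2: "ereal (blinfun_apply y x - r) \<le> conjugate J y" using r by (intro conjugate_ge) simp
    from 1 2 obtain s where s: "conjugate J y = ereal s" by (cases "conjugate J y") auto
    show "norm (real_of_ereal (conjugate J y) - real_of_ereal (conjugate J f)
        - blinfun_apply (eval_at x) (y - f)) \<le> e * norm (y - f)"
      using 1 2 e by (simp add: s f blinfun.diff_left abs_le_iff)
  qed
qed

lemma firm_growth_if_conjugate_frechet:
  fixes J :: "'a::real_normed_vector \<Rightarrow> ereal"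
  assumes closed: "closed (epi J)"
    and grad: "has_frechet_gradient (conjugate J) (eval_at x) f"
  shows "firm_growth J x f"
proof -
  obtain d where d: "0 < d" and fin: "\<And>v. dist v f < d \<Longrightarrow> \<bar>conjugate J v\<bar> \<noteq> \<infinity>"
    using grad unfolding has_frechet_gradient_def eventually_nhds_metric by blast
  obtain s where s: "conjugate J f = ereal s" using fin[of f] d by (cases "conjugate J f") auto
  show ?thesis
  proof (rule firm_growth_if_conjugate_upper[OF closed s])
    fix \<epsilon> :: real assume "0 < \<epsilon>"
    then obtain d' where d': "0 < d'" and up: "\<And>y. norm (y - f) < d' \<Longrightarrow>
        norm (real_of_ereal (conjugate J y) - s - blinfun_apply (y - f) x) \<le> \<epsilon> * norm (y - f)"
      using grad s unfolding has_frechet_gradient_def has_derivative_at_alt by fastforce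
    show "\<exists>\<delta>>0. \<forall>g. norm g \<le> \<delta> \<longrightarrow>
        conjugate J (f + g) \<le> ereal (s + blinfun_apply g x + \<epsilon> * norm g)"
    proof (intro exI[of _ "min d d' / 2"] conjI allI impI)
      fix g :: "'a \<Rightarrow>\<^sub>L real" assume g: "norm g \<le> min d d' / 2"
      have "\<bar>conjugate J (f + g)\<bar> \<noteq> \<infinity>" using fin[of "f + g"] g d d' by (simp add: dist_norm)
      then obtain b where b: "conjugate J (f + g) = ereal b" by (cases "conjugate J (f + g)") auto
      then show "conjugate J (f + g) \<le> ereal (s + blinfun_apply g x + \<epsilon> * norm g)"
        using up[of "f + g"] g d d' by (simp add: abs_le_iff)
    qed (use d d' in simp)
  qed
qed

section \<open>Firm growth and strong minima\<close>

lemma ereal_diff_real_le_iff: "X - ereal c \<le> ereal d \<longleftrightarrow> X \<le> ereal (d + c)"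
  by (cases X) auto

lemma strong_minimum_if_firm_growth:
  assumes proper: "proper_fun J" and firm: "firm_growth J x f"
  shows "attains_strong_minimum (\<lambda>u. J u - ereal (blinfun_apply f u))"
proof -
  obtain r where r: "J x = ereal r" using firm_growth_finite[OF firm] .
  define I where "I = (\<lambda>u. J u - ereal (blinfun_apply f u))"
  have Ix: "I x = ereal (r - blinfun_apply f x)" by (simp add: I_def r)
  have "proper_fun I"
  proof -
    have "I u \<noteq> - \<infinity>" for u using proper unfolding proper_fun_def I_def by (cases "J u") auto
    then show ?thesis using Ix by (auto simp: proper_fun_def eff_dom_def intro!: exI[of _ x])
  qed
  moreover have min: "I x \<le> I u" for u
    unfolding Ix ereal_le_iff_epigraph
  proof (intro allI impI)
    fix a assume "I u \<le> ereal a"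
    then have "J u \<le> ereal (a + blinfun_apply f u)" by (simp add: I_def ereal_diff_real_le_iff)
    then have "r + blinfun_apply f (u - x) \<le> a + blinfun_apply f u"
      using subdiff_if_firm_growth[OF firm] r by (auto simp: subdiff_iff)
    then show "r - blinfun_apply f x \<le> a" by (simp add: blinfun.diff_right)
  qed
  moreover have "u \<longlonglongrightarrow> x" if u: "(\<lambda>n. I (u n)) \<longlonglongrightarrow> (INF x. I x)" for u
    unfolding tendsto_iff
  proof (intro allI impI)
    fix e :: real assume e: "0 < e"
    have "(INF x. I x) = I x" by (intro antisym INF_lower INF_greatest min) auto
    with u have lim: "(\<lambda>n. I (u n)) \<longlonglongrightarrow> ereal (r - blinfun_apply f x)" by (simp add: Ix)
    obtain \<delta> where \<delta>: "0 < \<delta>"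
      and growth: "\<And>u a. J u \<le> ereal a \<Longrightarrow> r + blinfun_apply f (u - x) + \<delta> * (norm (u - x) - e / 4) \<le> a"
      using firm_growthD[OF firm r, of "e / 4"] e by auto
    have "\<forall>\<^sub>F n in sequentially. I (u n) < ereal (r - blinfun_apply f x + \<delta> * (e / 4))"
      using \<delta> e by (intro order_tendstoD(2)[OF lim]) simp
    then show "\<forall>\<^sub>F n in sequentially. dist (u n) x < e"
    proof eventually_elim
      case (elim n)
      then have "J (u n) \<le> ereal (r - blinfun_apply f x + \<delta> * (e / 4) + blinfun_apply f (u n))"
        unfolding I_def by (metis ereal_diff_real_le_iff less_imp_le)
      from growth[OF this] have "\<delta> * (norm (u n - x) - e / 4) \<le> \<delta> * (e / 4)"
        by (simp add: blinfun.diff_right)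
      then have "norm (u n - x) - e / 4 \<le> e / 4" using \<delta> by simp
      then show ?case using e by (simp add: dist_norm)
    qed
  qed
  ultimately show ?thesis unfolding attains_strong_minimum_def I_def by blast
qed

text \<open>Boundedness of the conjugate near \<open>f\<close> gives linear growth of \<open>J - f\<close> at infinity, and the
  strong minimum gives a positive gap \<open>\<eta>\<close> outside the ball of radius \<open>\<epsilon>\<close>. Together they give
  linear growth outside this ball.\<close>
lemma firm_growth_if_strong_minimum:
  assumes strong: "attains_strong_minimum (\<lambda>u. J u - ereal (blinfun_apply f u))"
    and \<rho>: "0 < \<rho>" and bounded: "\<And>g. norm g \<le> \<rho> \<Longrightarrow> conjugate J (f + g) \<le> ereal M"
  shows "\<exists>x. firm_growth J x f"
proof -
  define I where "I = (\<lambda>u. J u - ereal (blinfun_apply f u))"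
  obtain x where proper: "proper_fun I" and min: "\<And>u. I x \<le> I u"
    and strong: "\<And>u :: nat \<Rightarrow> 'a. (\<lambda>n. I (u n)) \<longlonglongrightarrow> (INF x. I x) \<Longrightarrow> u \<longlonglongrightarrow> x"
    using strong unfolding attains_strong_minimum_def I_def by blast
  obtain u0 a0 where "I u0 = ereal a0" using proper_fun_finite_point[OF proper] .
  then obtain m where m: "I x = ereal m"
    using min[of u0] proper by (cases "I x") (auto simp: proper_fun_def)
  then have r: "J x = ereal (m + blinfun_apply f x)" unfolding I_def by (cases "J x") auto
  have inf: "(INF x. I x) = ereal m"
    unfolding m[symmetric] by (intro antisym INF_lower INF_greatest min) auto
  have I_le: "I u \<le> ereal (a - blinfun_apply f u)" if "J u \<le> ereal a" for u a
    using that by (simp add: I_def ereal_diff_real_le_iff)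
  have m_le: "m + blinfun_apply f u \<le> a" if "J u \<le> ereal a" for u a
  proof -
    have "ereal m \<le> ereal (a - blinfun_apply f u)"
      unfolding m[symmetric] using min[of u] I_le[OF that] by (rule order_trans)
    then show ?thesis by simp
  qed
  have far: "\<exists>\<eta>>0. \<forall>u a. \<epsilon> \<le> norm (u - x) \<longrightarrow> J u \<le> ereal a \<longrightarrow> m + blinfun_apply f u + \<eta> \<le> a"
    if \<epsilon>: "0 < \<epsilon>" for \<epsilon>
  proof (rule ccontr)
    assume contra: "\<not> ?thesis"
    have "\<exists>u. \<epsilon> \<le> norm (u - x) \<and> I u \<le> ereal (m + inverse (Suc n))" for n
    proof -
      obtain u a where "\<epsilon> \<le> norm (u - x)" "J u \<le> ereal a"
        "\<not> m + blinfun_apply f u + inverse (Suc n) \<le> a"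
      proof -
        have "0 < inverse (real (Suc n))" by simp
        with contra show thesis using that by blast
      qed
      moreover from this have "I u \<le> ereal (m + inverse (Suc n))"
        by (intro order_trans[OF I_le[of u a]]) auto
      ultimately show ?thesis by blast
    qed
    then obtain u where u: "\<And>n. \<epsilon> \<le> norm (u n - x)" "\<And>n. I (u n) \<le> ereal (m + inverse (Suc n))" by metis
    have "(\<lambda>n. I (u n)) \<longlonglongrightarrow> ereal m"
    proof (rule tendsto_sandwich[where f = "\<lambda>_. ereal m" and h = "\<lambda>n. ereal (m + inverse (Suc n))"])
      show "\<forall>\<^sub>F n in sequentially. ereal m \<le> I (u n)" using min by (intro always_eventually) (simp flip: m)
      show "\<forall>\<^sub>F n in sequentially. I (u n) \<le> ereal (m + inverse (real (Suc n)))"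
        using u(2) by (intro always_eventually) auto
      have "(\<lambda>n. m + inverse (real (Suc n))) \<longlonglongrightarrow> m + 0"
        by (intro tendsto_intros LIMSEQ_inverse_real_of_nat)
      then show "(\<lambda>n. ereal (m + inverse (real (Suc n)))) \<longlonglongrightarrow> ereal m" by simp
    qed simp
    then have "u \<longlonglongrightarrow> x" using strong inf by simp
    then have "\<forall>\<^sub>F n in sequentially. dist (u n) x < \<epsilon>" using \<epsilon> by (rule tendstoD)
    then obtain n where "dist (u n) x < \<epsilon>" using eventually_happens trivial_limit_sequentially by blast
    then show False using u(1)[of n] by (simp add: dist_norm)
  qed
  have coercive: "m + blinfun_apply f u + \<rho> * norm (u - x) - (\<bar>M\<bar> + \<rho> * norm x + \<bar>m\<bar>) \<le> a"
    if u: "J u \<le> ereal a" for u a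
  proof -
    obtain h :: "'a \<Rightarrow>\<^sub>L real" where h: "norm h \<le> 1" "blinfun_apply h (u - x) = norm (u - x)"
      using norming_functional by blast
    have "norm (\<rho> *\<^sub>R h) \<le> \<rho>" using h \<rho> by simp
    then have "blinfun_apply (f + \<rho> *\<^sub>R h) u - M \<le> a" by (intro Fenchel_Young[OF bounded u])
    moreover have "norm (blinfun_apply h x) \<le> norm x"
      using norm_blinfun[of h x] h(1) mult_right_mono[OF h(1), of "norm x"] by simp
    then have "\<rho> * (- blinfun_apply h x) \<le> \<rho> * norm x" using \<rho> by (intro mult_left_mono) auto
    moreover have "\<rho> * blinfun_apply h u = \<rho> * norm (u - x) + \<rho> * blinfun_apply h x"
    proof -
      have "blinfun_apply h u = norm (u - x) + blinfun_apply h x"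
        using h(2) by (simp add: blinfun.diff_right)
      then show ?thesis by (simp add: distrib_left)
    qed
    ultimately show ?thesis by (simp add: blinfun.add_left blinfun.scaleR_left)
  qed
  define \<beta> where "\<beta> = \<bar>M\<bar> + \<rho> * norm x + \<bar>m\<bar>"
  have \<beta>: "0 \<le> \<beta>" using \<rho> by (simp add: \<beta>_def)
  have "\<exists>\<delta>>0. \<forall>u a. J u \<le> ereal a \<longrightarrow> m + blinfun_apply f u + \<delta> * (norm (u - x) - \<epsilon>) \<le> a"
    if \<epsilon>: "0 < \<epsilon>" for \<epsilon>
  proof -
    obtain \<eta> where \<eta>: "0 < \<eta>" and far: "\<And>u a. \<epsilon> \<le> norm (u - x) \<Longrightarrow> J u \<le> ereal a \<Longrightarrow>
        m + blinfun_apply f u + \<eta> \<le> a" using far[OF \<epsilon>] by blast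
    \<comment> \<open>The convex combination of the two bounds \<open>\<eta>\<close> and \<open>\<rho> t - \<beta>\<close> whose constant terms cancel.\<close>
    define \<theta> where "\<theta> = \<eta> / (\<eta> + \<beta>)"
    have \<theta>: "0 < \<theta>" "\<theta> \<le> 1" using \<eta> \<beta> by (auto simp: \<theta>_def)
    have bal: "(1 - \<theta>) * \<eta> = \<theta> * \<beta>" using \<eta> \<beta> by (simp add: \<theta>_def field_simps)
    have "m + blinfun_apply f u + (\<theta> * \<rho>) * (norm (u - x) - \<epsilon>) \<le> a" if u: "J u \<le> ereal a" for u a
    proof (cases "\<epsilon> \<le> norm (u - x)")
      case True
      have "(1 - \<theta>) * \<eta> \<le> (1 - \<theta>) * (a - (m + blinfun_apply f u))"
        using far[OF True u] \<theta> by (intro mult_left_mono) auto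
      moreover have "\<theta> * (\<rho> * norm (u - x) - \<beta>) \<le> \<theta> * (a - (m + blinfun_apply f u))"
        using coercive[OF u] \<theta> by (intro mult_left_mono) (auto simp: \<beta>_def)
      ultimately have "\<theta> * \<rho> * norm (u - x) \<le> a - (m + blinfun_apply f u)"
        using bal by (simp add: algebra_simps)
      moreover have "0 \<le> \<theta> * \<rho> * \<epsilon>" using \<theta> \<rho> \<epsilon> by simp
      ultimately show ?thesis by (simp add: right_diff_distrib)
    next
      case False
      then have "(\<theta> * \<rho>) * (norm (u - x) - \<epsilon>) \<le> 0"
        using \<theta> \<rho> by (intro mult_nonneg_nonpos) auto
      then show ?thesis using m_le[OF u] by simp
    qed
    then show ?thesis using \<theta> \<rho> by (intro exI[of _ "\<theta> * \<rho>"]) auto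
  qed
  moreover have eq: "m + blinfun_apply f x + blinfun_apply f (u - x) = m + blinfun_apply f u" for u
    by (simp add: blinfun.diff_right)
  ultimately have "\<forall>\<epsilon>>0. \<exists>\<delta>>0. \<forall>u a. J u \<le> ereal a \<longrightarrow>
      m + blinfun_apply f x + blinfun_apply f (u - x) + \<delta> * (norm (u - x) - \<epsilon>) \<le> a"
    unfolding eq by blast
  then have "firm_growth J x f" unfolding firm_growth_def using r by blast
  then show ?thesis ..
qed

section \<open>Essentially Frechet differentiable functions\<close>

text \<open>\<open>J - h\<close> has a minimum at \<open>y\<close>, where its derivative is \<open>g - h\<close>.\<close>
lemma subdiff_eq_frechet_gradient:
  assumes grad: "has_frechet_gradient J g y" and h: "h \<in> subdiff J y"
  shows "h = g"
proof -
  have "\<forall>\<^sub>F v in nhds y. \<bar>J v\<bar> \<noteq> \<infinity>" using grad by (simp add: has_frechet_gradient_def)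
  then obtain S where S: "open S" "y \<in> S" "\<forall>v\<in>S. \<bar>J v\<bar> \<noteq> \<infinity>"
    unfolding eventually_nhds by blast
  obtain r where r: "J y = ereal r" and sub: "\<And>v a. J v \<le> ereal a \<Longrightarrow> r + blinfun_apply h (v - y) \<le> a"
    using h by (auto simp: subdiff_iff)
  have 1: "((\<lambda>v. real_of_ereal (J v)) has_derivative blinfun_apply g) (at y)"
    using grad by (simp add: has_frechet_gradient_def)
  have 2: "(blinfun_apply h has_derivative blinfun_apply h) (at y)"
    by (rule bounded_linear_imp_has_derivative[OF blinfun.bounded_linear_right])
  have deriv: "((\<lambda>v. real_of_ereal (J v) - blinfun_apply h v) has_derivative
      (\<lambda>v. blinfun_apply g v - blinfun_apply h v)) (at y)"
    by (rule has_derivative_diff[OF 1 2])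
  have min: "real_of_ereal (J y) - blinfun_apply h y \<le> real_of_ereal (J v) - blinfun_apply h v"
    if v: "v \<in> S" for v
  proof -
    obtain b where b: "J v = ereal b" using bspec[OF S(3) v] by (cases "J v") auto
    then show ?thesis using sub[of v b] r by (simp add: blinfun.diff_right)
  qed
  have "(\<lambda>v. blinfun_apply g v - blinfun_apply h v) = (\<lambda>v. 0)"
    by (rule differential_zero_maxmin[OF S(2,1) deriv]) (use min in blast)
  then have "blinfun_apply g v - blinfun_apply h v = 0" for v by (rule fun_cong)
  then show ?thesis by (intro blinfun_eqI) simp
qed

lemma gradient_eq:
  assumes "has_frechet_gradient J g y"
  shows "gradient J y = g"
  unfolding gradient_def
proof (rule the_equality[where a = g])
  show "h = g" if "has_frechet_gradient J h y" for h
    using that assms has_derivative_unique unfolding has_frechet_gradient_def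
    by (metis blinfun_apply_inject)
qed (rule assms)

lemma norm_blinfun_le_if_bounded_above:
  fixes k :: "'a::real_normed_vector \<Rightarrow>\<^sub>L real"
  assumes \<rho>: "0 < \<rho>" and le: "\<And>w. norm w \<le> \<rho> \<Longrightarrow> blinfun_apply k w \<le> K"
  shows "norm k \<le> K / \<rho>"
proof (rule norm_blinfun_bound)
  show "0 \<le> K / \<rho>" using le[of 0] \<rho> by (simp add: blinfun.zero_right)
  fix w
  show "norm (blinfun_apply k w) \<le> K / \<rho> * norm w"
  proof (cases "w = 0")
    case False
    then have t: "0 < \<rho> / norm w" using \<rho> by simp
    have "blinfun_apply k ((\<rho> / norm w) *\<^sub>R w) \<le> K" "blinfun_apply k (- ((\<rho> / norm w) *\<^sub>R w)) \<le> K"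
      using False \<rho> by (auto intro!: le)
    then have "\<rho> / norm w * \<bar>blinfun_apply k w\<bar> \<le> K"
      using t by (simp add: blinfun.scaleR_right blinfun.minus_right abs_if)
    then show ?thesis using False \<rho> by (simp add: field_simps)
  qed (simp add: blinfun.zero_right)
qed

lemma convex_eff_dom:
  assumes "convex (epi J)"
  shows "convex (eff_dom J)"
  unfolding convex_alt
proof (intro ballI allI impI)
  fix x y and t :: real
  assume "x \<in> eff_dom J" "y \<in> eff_dom J" and t: "0 \<le> t \<and> t \<le> 1"
  then obtain a b where "J x \<le> ereal a" "J y \<le> ereal b" by (auto simp: mem_eff_dom_iff)
  then show "(1 - t) *\<^sub>R x + t *\<^sub>R y \<in> eff_dom J"
    using convex_epigraphD[OF assms, of x a y b t] t unfolding mem_eff_dom_iff by blast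
qed

lemma convex_segment_interior:
  fixes S :: "'a::real_normed_vector set"
  assumes S: "convex S" and y: "y \<in> interior S" and x: "x \<in> S" and s: "0 < s" "s \<le> 1"
  shows "x + s *\<^sub>R (y - x) \<in> interior S"
proof -
  obtain e where e: "0 < e" "ball y e \<subseteq> S" using y mem_interior by blast
  have "ball (x + s *\<^sub>R (y - x)) (s * e) \<subseteq> S"
  proof
    fix z assume z: "z \<in> ball (x + s *\<^sub>R (y - x)) (s * e)"
    define w where "w = (1 / s) *\<^sub>R (z - (x + s *\<^sub>R (y - x)))"
    have "norm w = norm (z - (x + s *\<^sub>R (y - x))) / s" using s by (simp add: w_def)
    also have "\<dots> < e" using z s by (simp add: dist_norm norm_minus_commute divide_less_eq mult.commute)
    finally have "norm w < e" .
    then have "y + w \<in> S" using e by (auto simp: dist_norm)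
    then have "(1 - s) *\<^sub>R x + s *\<^sub>R (y + w) \<in> S" using s by (intro convexD_alt[OF S x]) auto
    moreover have "(1 - s) *\<^sub>R x + s *\<^sub>R (y + w) = z"
      using s by (simp add: w_def algebra_simps)
    ultimately show "z \<in> S" by simp
  qed
  then show ?thesis using e s mem_interior by (metis mult_pos_pos)
qed

text \<open>A subgradient \<open>h\<close> at a boundary point \<open>x\<close> bounds the gradients on the segment from an
  interior point \<open>y\<close> to \<open>x\<close>: by monotonicity they cannot be very negative in the direction
  \<open>y - x\<close>, and the upper bound of \<open>J\<close> near \<open>y\<close> then controls them in all directions. This
  contradicts the blow-up at \<open>x\<close>.\<close>
theorem sv_dom_subdiff_if_ess_frechet:
  fixes J :: "'a::banach \<Rightarrow> ereal"
  assumes J: "ess_frechet_differentiable J"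
  shows "sv_dom (subdiff J) = interior (eff_dom J)"
proof
  have Gamma: "Gamma_fun J" using J by (simp add: ess_frechet_differentiable_def)
  then have closed: "closed (epi J)" and convex: "convex (epi J)" by (auto simp: Gamma_fun_iff)
  have ne: "interior (sv_dom (subdiff J)) \<noteq> {}"
    and grad: "\<forall>y\<in>interior (sv_dom (subdiff J)). \<exists>g. has_frechet_gradient J g y"
    and blowup: "\<forall>u z. (\<forall>n::nat. u n \<in> interior (eff_dom J)) \<and> u \<longlonglongrightarrow> z \<and> z \<in> frontier (eff_dom J) \<longrightarrow>
        filterlim (\<lambda>n. norm (gradient J (u n))) at_top sequentially"
    using J by (simp_all add: ess_frechet_differentiable_def)
  show sub: "interior (eff_dom J) \<subseteq> sv_dom (subdiff J)"
    by (rule interior_eff_dom_subset_sv_dom_subdiff[OF Gamma])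
  show "sv_dom (subdiff J) \<subseteq> interior (eff_dom J)"
  proof
    fix x assume "x \<in> sv_dom (subdiff J)"
    then obtain h where h: "h \<in> subdiff J x" by (auto simp: sv_dom_def)
    then obtain r where r: "J x = ereal r"
      and h_le: "\<And>v a. J v \<le> ereal a \<Longrightarrow> r + blinfun_apply h (v - x) \<le> a" by (auto simp: subdiff_iff)
    have x: "x \<in> eff_dom J" using r by (auto simp: eff_dom_def)
    show "x \<in> interior (eff_dom J)"
    proof (rule ccontr)
      assume notin: "x \<notin> interior (eff_dom J)"
      with x have frontier: "x \<in> frontier (eff_dom J)"
        using closure_subset[of "eff_dom J"] by (auto simp: frontier_def)
      obtain y where "y \<in> interior (sv_dom (subdiff J))" using ne by blast
      then have y: "y \<in> interior (eff_dom J)" using interior_mono[OF sv_dom_subdiff_subset] by blast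
      obtain \<rho> M where \<rho>: "0 < \<rho>" and M: "\<And>v. norm (v - y) \<le> \<rho> \<Longrightarrow> J v \<le> ereal M"
        using convex_lsc_locally_bounded_above[OF closed convex y] by blast
      define s where "s = (\<lambda>n. inverse (real (Suc n)))"
      define u where "u = (\<lambda>n. x + s n *\<^sub>R (y - x))"
      have s: "0 < s n" "s n \<le> 1" for n by (auto simp: s_def inverse_le_1_iff)
      have u_int: "u n \<in> interior (eff_dom J)" for n
        unfolding u_def using s by (intro convex_segment_interior convex_eff_dom convex y x) auto
      have "u \<longlonglongrightarrow> x + 0 *\<^sub>R (y - x)"
        unfolding u_def s_def by (intro tendsto_intros LIMSEQ_inverse_real_of_nat)
      then have "u \<longlonglongrightarrow> x" by simp
      then have "filterlim (\<lambda>n. norm (gradient J (u n))) at_top sequentially"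
        using blowup u_int frontier by blast
      then have "\<forall>\<^sub>F n in sequentially. K / \<rho> + 1 \<le> norm (gradient J (u n))" for K
        unfolding filterlim_at_top by blast
      then have large: "\<exists>n. K / \<rho> + 1 \<le> norm (gradient J (u n))" for K
        using eventually_happens' sequentially_bot by blast
      define K where "K = M - r + \<bar>blinfun_apply h (y - x)\<bar>"
      have bounded: "norm (gradient J (u n)) \<le> K / \<rho>" for n
      proof -
        have "u n \<in> interior (sv_dom (subdiff J))"
          using u_int[of n] interior_maximal[OF sub open_interior] by blast
        then obtain g where g: "has_frechet_gradient J g (u n)" using grad by blast
        obtain k where k: "k \<in> subdiff J (u n)" using sub u_int[of n] by (auto simp: sv_dom_def)
        have "gradient J (u n) \<in> subdiff J (u n)"
          unfolding gradient_eq[OF g] using k subdiff_eq_frechet_gradient[OF g k] by simp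
        then obtain rn where rn: "J (u n) = ereal rn" and k_le: "\<And>v a. J v \<le> ereal a \<Longrightarrow>
            rn + blinfun_apply (gradient J (u n)) (v - u n) \<le> a" by (auto simp: subdiff_iff)
        define k where "k = gradient J (u n)"
        \<comment> \<open>Monotonicity between \<open>x\<close> and \<open>u n\<close> bounds \<open>k\<close> from below in the direction \<open>y - x\<close>.\<close>
        have 1: "s n * blinfun_apply h (y - x) \<le> rn - r"
          using h_le[of "u n" rn] rn by (simp add: u_def blinfun.scaleR_right)
        have 2: "rn - r \<le> s n * blinfun_apply k (y - x)"
          using k_le[of x r] r by (simp add: u_def k_def blinfun.scaleR_right blinfun.minus_right)
        have 3: "blinfun_apply h (y - x) \<le> blinfun_apply k (y - x)"
          using order_trans[OF 1 2] s[of n] by simp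
        have "blinfun_apply k w \<le> K" if w: "norm w \<le> \<rho>" for w
        proof -
          have "rn + blinfun_apply k (y + w - u n) \<le> M"
            using k_le[OF M[of "y + w"]] w by (simp add: k_def)
          moreover have "y + w - u n = w + (1 - s n) *\<^sub>R (y - x)"
            by (simp add: u_def algebra_simps)
          ultimately have "rn + blinfun_apply k w + (1 - s n) * blinfun_apply k (y - x) \<le> M"
            by (simp add: blinfun.add_right blinfun.scaleR_right)
          moreover have "(1 - s n) * blinfun_apply h (y - x) \<le> (1 - s n) * blinfun_apply k (y - x)"
            using 3 s[of n] by (intro mult_left_mono) auto
          ultimately have "blinfun_apply k w \<le> M - r - blinfun_apply h (y - x)"
            using 1 by (simp add: left_diff_distrib)
          then show ?thesis unfolding K_def by linarith
        qed
        then show ?thesis unfolding k_def[symmetric] by (intro norm_blinfun_le_if_bounded_above \<rho>)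
      qed
      obtain n where "K / \<rho> + 1 \<le> norm (gradient J (u n))" using large by blast
      with bounded[of n] show False by simp
    qed
  qed
qed

section \<open>Strong adequacy and the conjugate\<close>

text \<open>The common reformulation of strong adequacy and of essential Frechet differentiability of
  the conjugate.\<close>
definition firm_growth_on_conjugate_dom :: "('a::real_normed_vector \<Rightarrow> ereal) \<Rightarrow> bool" where
  "firm_growth_on_conjugate_dom J \<longleftrightarrow> sv_dom (subdiff (conjugate J)) \<noteq> {} \<and>
     (\<forall>f\<in>sv_dom (subdiff (conjugate J)). \<exists>x. firm_growth J x f)"

lemma Gamma_fun_conjugate_if_sv_dom:
  assumes "proper_fun J" "sv_dom (subdiff (conjugate J)) \<noteq> {}"
  shows "Gamma_fun (conjugate J)"
  using assms sv_dom_subdiff_subset[of "conjugate J"] by (intro Gamma_fun_conjugate) auto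

lemma sv_dom_subdiff_conjugate_if_firm_growth:
  assumes "proper_fun J" "firm_growth_on_conjugate_dom J"
  shows "sv_dom (subdiff (conjugate J)) = interior (eff_dom (conjugate J))"
proof
  show "sv_dom (subdiff (conjugate J)) \<subseteq> interior (eff_dom (conjugate J))"
    using assms(2) firm_growth_interior unfolding firm_growth_on_conjugate_dom_def by blast
  show "interior (eff_dom (conjugate J)) \<subseteq> sv_dom (subdiff (conjugate J))"
    using assms by (intro interior_eff_dom_subset_sv_dom_subdiff Gamma_fun_conjugate_if_sv_dom)
      (auto simp: firm_growth_on_conjugate_dom_def)
qed

theorem strongly_adequate_iff_firm_growth:
  assumes proper: "proper_fun J"
  shows "strongly_adequate J \<longleftrightarrow> firm_growth_on_conjugate_dom J"
proof
  assume J: "strongly_adequate J"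
  define D where "D = sv_dom (subdiff (conjugate J))"
  have D: "D \<noteq> {}" "open D" and strong: "\<And>f. f \<in> D \<Longrightarrow>
      attains_strong_minimum (\<lambda>x. J x - ereal (blinfun_apply f x))"
    using J unfolding strongly_adequate_def D_def by auto
  have "\<exists>x. firm_growth J x f" if f: "f \<in> D" for f
  proof -
    have "D \<subseteq> interior (eff_dom (conjugate J))"
      using D(2) sv_dom_subdiff_subset unfolding D_def by (intro interior_maximal)
    then obtain \<rho> M where \<rho>: "0 < \<rho>"
      and M: "\<And>v. norm (v - f) \<le> \<rho> \<Longrightarrow> conjugate J v \<le> ereal M"
      using convex_lsc_locally_bounded_above[OF closed_epi_conjugate convex_epi_conjugate] f by blast
    show ?thesis
      using M[of "f + g" for g] by (intro firm_growth_if_strong_minimum[OF strong[OF f] \<rho>]) simp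
  qed
  then show "firm_growth_on_conjugate_dom J"
    using D unfolding firm_growth_on_conjugate_dom_def D_def by blast
next
  assume J: "firm_growth_on_conjugate_dom J"
  have "open (sv_dom (subdiff (conjugate J)))"
    unfolding sv_dom_subdiff_conjugate_if_firm_growth[OF proper J] by simp
  then show "strongly_adequate J"
    using J proper strong_minimum_if_firm_growth[OF proper]
    unfolding strongly_adequate_def firm_growth_on_conjugate_dom_def by blast
qed

text \<open>The blow-up at the boundary holds because a boundary point that is approached with bounded
  gradients inherits a subgradient from them, and so lies in the domain of the subdifferential,
  which is open.\<close>
theorem ess_frechet_conjugate_iff_firm_growth:
  fixes J :: "'a::banach \<Rightarrow> ereal"
  assumes refl: "reflexive_space TYPE('a)" and proper: "proper_fun J" and closed: "closed (epi J)"
  shows "ess_frechet_differentiable (conjugate J) \<longleftrightarrow> firm_growth_on_conjugate_dom J"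
proof
  assume J: "ess_frechet_differentiable (conjugate J)"
  define D where "D = sv_dom (subdiff (conjugate J))"
  have D_int: "interior D = D"
    unfolding D_def sv_dom_subdiff_if_ess_frechet[OF J] by simp
  have ne: "interior D \<noteq> {}" and grad: "\<And>f. f \<in> interior D \<Longrightarrow> \<exists>g. has_frechet_gradient (conjugate J) g f"
    using J unfolding ess_frechet_differentiable_def D_def by auto
  have "\<exists>x. firm_growth J x f" if f: "f \<in> D" for f
  proof -
    obtain g where "has_frechet_gradient (conjugate J) g f" using grad f D_int by auto
    moreover obtain x where "g = eval_at x" using reflexive_spaceE[OF refl] .
    ultimately show ?thesis using firm_growth_if_conjugate_frechet[OF closed] by blast
  qed
  then show "firm_growth_on_conjugate_dom J"
    using ne D_int unfolding firm_growth_on_conjugate_dom_def D_def by auto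
next
  assume J: "firm_growth_on_conjugate_dom J"
  let ?G = "conjugate J"
  define D where "D = sv_dom (subdiff ?G)"
  have D: "D = interior (eff_dom ?G)"
    unfolding D_def by (rule sv_dom_subdiff_conjugate_if_firm_growth[OF proper J])
  have ne: "D \<noteq> {}" and firm: "\<And>f. f \<in> D \<Longrightarrow> \<exists>x. firm_growth J x f"
    using J unfolding firm_growth_on_conjugate_dom_def D_def by auto
  have Gamma: "Gamma_fun ?G" using Gamma_fun_conjugate_if_sv_dom[OF proper] ne by (simp add: D_def)
  have grad: "\<exists>g. has_frechet_gradient ?G g f" if "f \<in> D" for f
    using firm[OF that] conjugate_frechet_if_firm_growth[OF proper] by blast
  have "filterlim (\<lambda>n. norm (gradient ?G (u n))) at_top sequentially"
    if u: "\<And>n. u n \<in> interior (eff_dom ?G)" "u \<longlonglongrightarrow> z" and z: "z \<in> frontier (eff_dom ?G)" for u z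
  proof (rule ccontr)
    assume "\<not> ?thesis"
    then obtain K where "\<not> (\<forall>\<^sub>F n in sequentially. K \<le> norm (gradient ?G (u n)))"
      unfolding filterlim_at_top by blast
    then obtain i :: "nat \<Rightarrow> nat" where i: "strict_mono i" "\<And>n. \<not> K \<le> norm (gradient ?G (u (i n)))"
      using not_eventually_sequentiallyD[of "\<lambda>n. K \<le> norm (gradient ?G (u n))"] by blast
    have lim: "(\<lambda>n. u (i n)) \<longlonglongrightarrow> z" using LIMSEQ_subseq_LIMSEQ[OF u(2) i(1)] by (simp add: o_def)
    \<comment> \<open>The bounded gradients give downward cones below the graph, and these pass to the limit.\<close>
    have cone: "?G z \<le> ereal (a + K * norm (v - z))" if v: "?G v \<le> ereal a" for v a
    proof (rule closed_epigraphD[OF closed_epi_conjugate lim])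
      show "(\<lambda>n. a + K * norm (v - u (i n))) \<longlonglongrightarrow> a + K * norm (v - z)"
        by (intro tendsto_intros lim)
      fix n
      have "u (i n) \<in> D" using u D by auto
      then obtain g where g: "has_frechet_gradient ?G g (u (i n))" using grad by blast
      obtain k where k: "k \<in> subdiff ?G (u (i n))"
        using \<open>u (i n) \<in> D\<close> by (auto simp: D_def sv_dom_def)
      then have "k = gradient ?G (u (i n))"
        using subdiff_eq_frechet_gradient[OF g k] gradient_eq[OF g] by simp
      then have norm: "norm k \<le> K" using i(2)[of n] by simp
      obtain rn where rn: "?G (u (i n)) = ereal rn" and "rn + blinfun_apply k (v - u (i n)) \<le> a"
        using k v by (auto simp: subdiff_iff)
      moreover have "- blinfun_apply k (v - u (i n)) \<le> norm k * norm (v - u (i n))"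
        using norm_blinfun[of k "v - u (i n)"] by simp
      moreover have "norm k * norm (v - u (i n)) \<le> K * norm (v - u (i n))"
        using norm by (intro mult_right_mono) auto
      ultimately show "?G (u (i n)) \<le> ereal (a + K * norm (v - u (i n)))" by simp
    qed
    obtain f0 where "f0 \<in> eff_dom ?G" using Gamma by (auto simp: Gamma_fun_def proper_fun_def)
    then obtain a0 where "?G f0 \<le> ereal a0" by (auto simp: mem_eff_dom_iff)
    from cone[OF this] have "z \<in> eff_dom ?G" by (auto simp: mem_eff_dom_iff)
    then obtain r where r: "?G z = ereal r" by (rule conjugate_finite[OF proper])
    have "0 \<le> K" using i(2)[of 0] by (metis linear norm_ge_zero order_trans)
    moreover have "r - K * norm (v - z) \<le> a" if "?G v \<le> ereal a" for v a
      using cone[OF that] r by simp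
    ultimately have "\<exists>g\<in>subdiff ?G z. norm g \<le> K"
      by (rule subgradient_above_cone[OF convex_epi_conjugate r])
    then have "z \<in> D" by (auto simp: D_def sv_dom_def)
    then show False using z D by (simp add: frontier_def)
  qed
  moreover have "interior D = D" unfolding D by simp
  ultimately show "ess_frechet_differentiable ?G"
    using Gamma ne grad unfolding ess_frechet_differentiable_def D_def[symmetric] by auto
qed

section \<open>Convexity from firm growth\<close>

text \<open>The evaluations at \<open>x\<close> and at \<open>y\<close> are both the gradient of the conjugate at \<open>f\<close>, and
  functionals separate points.\<close>
lemma firm_growth_unique:
  assumes proper: "proper_fun J" and firm: "firm_growth J x f" and y: "eval_at y \<in> subdiff (conjugate J) f"
  shows "y = x"
proof (rule ccontr)
  assume "y \<noteq> x"
  obtain g :: "'a \<Rightarrow>\<^sub>L real" where g: "blinfun_apply g (y - x) = norm (y - x)"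
    using norming_functional by blast
  have "eval_at y = eval_at x"
    using subdiff_eq_frechet_gradient[OF conjugate_frechet_if_firm_growth[OF proper firm] y] .
  then have "blinfun_apply g y = blinfun_apply g x" by (metis eval_at_apply)
  then have "norm (y - x) = 0" using g by (simp add: blinfun.diff_right)
  then show False using \<open>y \<noteq> x\<close> by simp
qed

text \<open>The set above all affine minorants of \<open>J\<close>, hence the epigraph of the biconjugate restricted
  to the space itself.\<close>
definition biconjugate_epi :: "('a::real_normed_vector \<Rightarrow> ereal) \<Rightarrow> ('a \<times> real) set" where
  "biconjugate_epi J = (\<Inter>q\<in>epi (conjugate J). {p. blinfun_apply (fst q) (fst p) - snd q \<le> snd p})"

lemma mem_biconjugate_epi:
  "(x, a) \<in> biconjugate_epi J \<longleftrightarrow> (\<forall>f b. conjugate J f \<le> ereal b \<longrightarrow> blinfun_apply f x - b \<le> a)"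
  by (simp only: biconjugate_epi_def INT_iff mem_Collect_eq Ball_def split_paired_All mem_epigraph
      fst_conv snd_conv)

lemma epi_subset_biconjugate_epi: "J x \<le> ereal a \<Longrightarrow> (x, a) \<in> biconjugate_epi J"
  by (auto simp: mem_biconjugate_epi intro: Fenchel_Young)

lemma closed_biconjugate_epi: "closed (biconjugate_epi J)"
  unfolding biconjugate_epi_def by (intro closed_INT ballI closed_Collect_le continuous_intros)

lemma convex_biconjugate_epi: "convex (biconjugate_epi J)"
proof (rule convexI)
  fix p q and s t :: real
  assume "p \<in> biconjugate_epi J" "q \<in> biconjugate_epi J" and st: "0 \<le> s" "0 \<le> t" "s + t = 1"
  then obtain x a y b where pq: "p = (x, a)" "q = (y, b)"
    and xy: "(x, a) \<in> biconjugate_epi J" "(y, b) \<in> biconjugate_epi J" by (cases p, cases q) auto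
  have "blinfun_apply f (s *\<^sub>R x + t *\<^sub>R y) - c \<le> s * a + t * b" if "conjugate J f \<le> ereal c" for f c
  proof -
    have "blinfun_apply f x - c \<le> a" "blinfun_apply f y - c \<le> b"
      using xy that by (simp_all add: mem_biconjugate_epi)
    then have "s * (blinfun_apply f x - c) \<le> s * a" "t * (blinfun_apply f y - c) \<le> t * b"
      using st by (simp_all add: mult_left_mono)
    moreover have "s * c + t * c = c" using st by (simp flip: distrib_right)
    ultimately show ?thesis by (simp add: blinfun.add_right blinfun.scaleR_right right_diff_distrib)
  qed
  then show "s *\<^sub>R p + t *\<^sub>R q \<in> biconjugate_epi J" by (simp add: pq mem_biconjugate_epi)
qed

text \<open>Near each point of a closed convex set above an affine function there is one at which the
  set has a supporting functional: apply Ekeland's principle to the set tilted by \<open>f0\<close>. A large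
  \<open>\<epsilon>\<close> forces \<open>y\<close> close to \<open>x\<close>.\<close>
lemma Bronsted_Rockafellar:
  fixes E :: "('a::banach \<times> real) set"
  assumes closed: "closed E" and convex: "convex E" and x: "(x, a) \<in> E" and n: "0 < \<epsilon>"
    and minorant: "\<And>v b. (v, b) \<in> E \<Longrightarrow> blinfun_apply f0 v - b0 \<le> b"
  shows "\<exists>y c f. (y, c) \<in> E \<and> c - blinfun_apply f0 y + \<epsilon> * norm (y - x) \<le> a - blinfun_apply f0 x \<and>
    (\<forall>v b. (v, b) \<in> E \<longrightarrow> c + blinfun_apply f (v - y) \<le> b)"
proof -
  define E' where "E' = {p. (fst p, snd p + blinfun_apply f0 (fst p)) \<in> E}"
  have E': "(v, b) \<in> E' \<longleftrightarrow> (v, b + blinfun_apply f0 v) \<in> E" for v b by (simp add: E'_def)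
  have "closed ((\<lambda>p. (fst p, snd p + blinfun_apply f0 (fst p))) -` E)"
    by (intro closed_vimage closed continuous_intros)
  then have "closed E'" by (simp add: E'_def vimage_def)
  moreover have "(x, a - blinfun_apply f0 x) \<in> E'" using x by (simp add: E')
  moreover have "- b0 \<le> b" if "(v, b) \<in> E'" for v b
    using minorant[of v "b + blinfun_apply f0 v"] that by (simp add: E')
  ultimately obtain y d where y: "(y, d) \<in> E'"
    and start: "d + \<epsilon> * dist y x \<le> a - blinfun_apply f0 x"
    and ekeland: "\<And>v b. (v, b) \<in> E' \<Longrightarrow> d - \<epsilon> * dist v y \<le> b"
    using Ekeland_set[of E' "- b0" x "a - blinfun_apply f0 x" \<epsilon>] n by blast
  define c where "c = d + blinfun_apply f0 y"
  have "c - (norm f0 + \<epsilon>) * norm (v - y) \<le> b" if "(v, b) \<in> E" for v b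
  proof -
    have "(v, b - blinfun_apply f0 v) \<in> E'" using that by (simp add: E')
    from ekeland[OF this] have "d - \<epsilon> * norm (v - y) + blinfun_apply f0 v \<le> b" by (simp add: dist_norm)
    moreover have "- blinfun_apply f0 (v - y) \<le> norm f0 * norm (v - y)"
      using norm_blinfun[of f0 "v - y"] by simp
    ultimately show ?thesis by (simp add: c_def blinfun.diff_right distrib_right)
  qed
  then obtain f where "\<forall>v b. (v, b) \<in> E \<longrightarrow> c + blinfun_apply f (v - y) \<le> b"
    using affine_minorant_above_cone[OF convex, of "norm f0 + \<epsilon>" c y] n by auto
  moreover have "(y, c) \<in> E" using y by (simp add: E' c_def)
  moreover have "c - blinfun_apply f0 y + \<epsilon> * norm (y - x) \<le> a - blinfun_apply f0 x"
    using start by (simp add: c_def dist_norm)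
  ultimately show ?thesis by blast
qed

text \<open>A point at which the biconjugate has a subgradient \<open>f\<close> is the point of firm growth along
  \<open>f\<close>, so \<open>J\<close> and its biconjugate agree there. Ekeland's principle approximates each \<open>x\<close> by such
  points with values not above that at \<open>x\<close> in the limit, and the epigraph of \<open>J\<close> is closed.\<close>
theorem convex_if_firm_growth_on_conjugate_dom:
  fixes J :: "'a::banach \<Rightarrow> ereal"
  assumes proper: "proper_fun J" and closed: "closed (epi J)" and firm: "firm_growth_on_conjugate_dom J"
  shows "convex (epi J)"
proof -
  let ?G = "conjugate J"
  have ne: "sv_dom (subdiff ?G) \<noteq> {}"
    using firm by (simp add: firm_growth_on_conjugate_dom_def)
  obtain f0 b0 where f0: "?G f0 \<le> ereal b0"
    using ne sv_dom_subdiff_subset[of ?G] by (fastforce simp: mem_eff_dom_iff)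
  have "J x \<le> ereal a" if x: "(x, a) \<in> biconjugate_epi J" for x a
  proof -
    \<comment> \<open>At a point with a subgradient \<open>f\<close> the Fenchel-Young inequality is an equality, which puts \<open>f\<close> in the domain.\<close>
    have exposed: "J y \<le> ereal c" if y: "(y, c) \<in> biconjugate_epi J"
      and f: "\<forall>v b. (v, b) \<in> biconjugate_epi J \<longrightarrow> c + blinfun_apply f (v - y) \<le> b" for y c f
    proof -
      have le: "?G f \<le> ereal (blinfun_apply f y - c)"
        unfolding conjugate_le_iff
      proof (intro allI impI)
        fix u a assume "J u \<le> ereal a"
        then have "c + blinfun_apply f (u - y) \<le> a" using f epi_subset_biconjugate_epi by blast
        then show "blinfun_apply f u - (blinfun_apply f y - c) \<le> a" by (simp add: blinfun.diff_right)
      qed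
      have ge: "blinfun_apply g y - c \<le> b" if "?G g \<le> ereal b" for g b
      proof -
        have "blinfun_apply g y - b \<le> c" using y that by (simp add: mem_biconjugate_epi)
        then show ?thesis by simp
      qed
      have "ereal (blinfun_apply f y - c) \<le> ?G f"
        unfolding ereal_le_iff_epigraph using ge by blast
      with le have eq: "?G f = ereal (blinfun_apply f y - c)" by (rule antisym)
      have sub: "eval_at y \<in> subdiff ?G f"
        unfolding subdiff_iff
      proof (intro exI[of _ "blinfun_apply f y - c"] conjI eq allI impI)
        fix g b assume "?G g \<le> ereal b"
        from ge[OF this] show "blinfun_apply f y - c + blinfun_apply (eval_at y) (g - f) \<le> b"
          by (simp add: blinfun.diff_left)
      qed
      then have "f \<in> sv_dom (subdiff ?G)" by (auto simp: sv_dom_def)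
      then obtain z where z: "firm_growth J z f"
        using firm by (auto simp: firm_growth_on_conjugate_dom_def)
      have "y = z" by (rule firm_growth_unique[OF proper z sub])
      then obtain r where r: "J y = ereal r" using firm_growth_finite[OF z] by blast
      have "?G f = ereal (blinfun_apply f y - r)"
        using conjugate_eq_if_subdiff[OF subdiff_if_firm_growth[OF z]] r \<open>y = z\<close> by simp
      then show ?thesis using eq r by simp
    qed
    have step: "\<exists>y c f. (y, c) \<in> biconjugate_epi J \<and>
        c - blinfun_apply f0 y + real (Suc n) * norm (y - x) \<le> a - blinfun_apply f0 x \<and>
        (\<forall>v b. (v, b) \<in> biconjugate_epi J \<longrightarrow> c + blinfun_apply f (v - y) \<le> b)" for n
    proof (rule Bronsted_Rockafellar[OF closed_biconjugate_epi convex_biconjugate_epi x])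
      show "blinfun_apply f0 v - b0 \<le> b" if "(v, b) \<in> biconjugate_epi J" for v b
        using that f0 by (simp add: mem_biconjugate_epi)
    qed simp
    obtain y c where y: "\<And>n. (y n, c n) \<in> biconjugate_epi J" "\<And>n. J (y n) \<le> ereal (c n)"
      and near: "\<And>n. c n - blinfun_apply f0 (y n) + real (Suc n) * norm (y n - x) \<le> a - blinfun_apply f0 x"
    proof -
      obtain y c f where ycf: "\<forall>n. (y n, c n) \<in> biconjugate_epi J \<and>
          c n - blinfun_apply f0 (y n) + real (Suc n) * norm (y n - x) \<le> a - blinfun_apply f0 x \<and>
          (\<forall>v b. (v, b) \<in> biconjugate_epi J \<longrightarrow> c n + blinfun_apply (f n) (v - y n) \<le> b)"
        using step by metis
      show thesis
      proof (rule that[of y c])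
        show "J (y n) \<le> ereal (c n)" for n using ycf exposed[of "y n" "c n" "f n"] by blast
      qed (use ycf in blast)+
    qed
    define K where "K = a - blinfun_apply f0 x + b0"
    have "norm (y n - x) \<le> K * inverse (real (Suc n))" for n
    proof -
      have "blinfun_apply f0 (y n) - b0 \<le> c n" using y(1) f0 by (simp add: mem_biconjugate_epi)
      then have "real (Suc n) * norm (y n - x) \<le> K" using near[of n] by (simp add: K_def)
      then show ?thesis by (simp add: field_simps)
    qed
    moreover have "(\<lambda>n. K * inverse (real (Suc n))) \<longlonglongrightarrow> K * 0"
      by (intro tendsto_intros LIMSEQ_inverse_real_of_nat)
    ultimately have "(\<lambda>n. y n - x) \<longlonglongrightarrow> 0"
      using Lim_null_comparison[of "\<lambda>n. y n - x" "\<lambda>n. K * inverse (real (Suc n))" sequentially] by simp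
    then have lim: "y \<longlonglongrightarrow> x" by (rule LIM_zero_cancel)
    then have "(\<lambda>n. a - blinfun_apply f0 x + blinfun_apply f0 (y n)) \<longlonglongrightarrow>
        a - blinfun_apply f0 x + blinfun_apply f0 x" by (intro tendsto_intros)
    moreover have "J (y n) \<le> ereal (a - blinfun_apply f0 x + blinfun_apply f0 (y n))" for n
    proof -
      have "0 \<le> real (Suc n) * norm (y n - x)" by simp
      then have "c n \<le> a - blinfun_apply f0 x + blinfun_apply f0 (y n)" using near[of n] by linarith
      then show ?thesis using order_trans[OF y(2)[of n]] by simp
    qed
    ultimately have "J x \<le> ereal (a - blinfun_apply f0 x + blinfun_apply f0 x)"
      by (rule closed_epigraphD[OF closed lim])
    then show ?thesis by simp
  qed
  then have "epi J = biconjugate_epi J" using epi_subset_biconjugate_epi by auto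
  then show ?thesis using convex_biconjugate_epi by simp
qed

section \<open>Firm growth along all subgradients\<close>

definition firm_growth_on_subdiff :: "('a::real_normed_vector \<Rightarrow> ereal) \<Rightarrow> bool" where
  "firm_growth_on_subdiff J \<longleftrightarrow>
     convex (epi J) \<and> (\<forall>x. \<forall>f\<in>subdiff J x. firm_growth J x f)"

text \<open>Otherwise an affine minorant of \<open>J\<close> passes above the value at \<open>x\<close> that the conjugate
  predicts, and its slope violates the subgradient inequality of the conjugate.\<close>
lemma subdiff_if_subdiff_conjugate:
  assumes Gamma: "Gamma_fun J" and x: "eval_at x \<in> subdiff (conjugate J) f"
  shows "f \<in> subdiff J x"
proof -
  obtain s where s: "conjugate J f = ereal s"
    and sub: "\<And>g b. conjugate J g \<le> ereal b \<Longrightarrow> s + blinfun_apply (g - f) x \<le> b"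
    using x by (auto simp: subdiff_iff)
  have "J x \<le> ereal (blinfun_apply f x - s)"
  proof (rule ccontr)
    assume "\<not> ?thesis"
    then obtain c where c: "blinfun_apply f x - s < c" "ereal c < J x"
      using ereal_dense2[of "ereal (blinfun_apply f x - s)" "J x"] by (auto simp: not_le)
    obtain g where g: "\<forall>v a. J v \<le> ereal a \<longrightarrow> c + blinfun_apply g (v - x) \<le> a"
      using convex_lsc_affine_minorant_through[OF Gamma c(2)] by blast
    have "conjugate J g \<le> ereal (blinfun_apply g x - c)"
      using g by (fastforce simp: conjugate_le_iff blinfun.diff_right)
    from sub[OF this] c(1) show False by (simp add: blinfun.diff_left)
  qed
  moreover have "ereal (blinfun_apply f x - s) \<le> J x"
    using Fenchel_Young[of J f s x] s by (simp add: ereal_le_iff_epigraph)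
  ultimately have "J x = ereal (blinfun_apply f x - s)" by (rule antisym)
  then show ?thesis using s by (intro subdiff_if_conjugate_le) auto
qed

theorem firm_growth_on_subdiff_iff:
  fixes J :: "'a::banach \<Rightarrow> ereal"
  assumes refl: "reflexive_space TYPE('a)" and proper: "proper_fun J" and closed: "closed (epi J)"
  shows "firm_growth_on_subdiff J \<longleftrightarrow> firm_growth_on_conjugate_dom J"
proof
  assume J: "firm_growth_on_conjugate_dom J"
  have "firm_growth J x f" if f: "f \<in> subdiff J x" for x f
  proof -
    have x: "eval_at x \<in> subdiff (conjugate J) f" by (rule subdiff_conjugate_if_subdiff[OF f])
    then have "f \<in> sv_dom (subdiff (conjugate J))" by (auto simp: sv_dom_def)
    then obtain z where "firm_growth J z f" using J by (auto simp: firm_growth_on_conjugate_dom_def)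
    then show ?thesis using firm_growth_unique[OF proper _ x] by blast
  qed
  then show "firm_growth_on_subdiff J"
    using convex_if_firm_growth_on_conjugate_dom[OF proper closed J]
    by (simp add: firm_growth_on_subdiff_def)
next
  assume J: "firm_growth_on_subdiff J"
  then have Gamma: "Gamma_fun J"
    using proper closed by (simp add: Gamma_fun_iff firm_growth_on_subdiff_def)
  have "\<exists>x. firm_growth J x f" if f: "f \<in> sv_dom (subdiff (conjugate J))" for f
  proof -
    obtain \<phi> where \<phi>: "\<phi> \<in> subdiff (conjugate J) f" using f by (auto simp: sv_dom_def)
    obtain x where x: "\<phi> = eval_at x" using reflexive_spaceE[OF refl] .
    have "f \<in> subdiff J x" using \<phi> x by (intro subdiff_if_subdiff_conjugate[OF Gamma]) simp
    then show ?thesis using J by (auto simp: firm_growth_on_subdiff_def)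
  qed
  moreover have "sv_dom (subdiff (conjugate J)) \<noteq> {}"
  proof -
    obtain x a where x: "J x = ereal a" using proper_fun_finite_point[OF proper] .
    then have "ereal (a - 1) < J x" by simp
    then obtain g where g: "\<forall>v b. J v \<le> ereal b \<longrightarrow> a - 1 + blinfun_apply g (v - x) \<le> b"
      using convex_lsc_affine_minorant_through[OF Gamma] by blast
    have "\<exists>y c f. (y, c) \<in> epi J \<and> c - blinfun_apply g y + 1 * norm (y - x) \<le> a - blinfun_apply g x \<and>
        (\<forall>v b. (v, b) \<in> epi J \<longrightarrow> c + blinfun_apply f (v - y) \<le> b)"
      using Gamma x g
      by (intro Bronsted_Rockafellar[where ?b0.0 = "blinfun_apply g x - (a - 1)"])
        (auto simp: Gamma_fun_iff blinfun.diff_right algebra_simps)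
    then obtain y c f where y: "J y \<le> ereal c"
      and f: "\<And>v b. J v \<le> ereal b \<Longrightarrow> c + blinfun_apply f (v - y) \<le> b" by auto
    have "ereal c \<le> J y"
      using f[of y] by (simp add: ereal_le_iff_epigraph blinfun.zero_right)
    with y have "J y = ereal c" by (rule antisym)
    with f have "f \<in> subdiff J y" by (auto simp: subdiff_iff)
    from subdiff_conjugate_if_subdiff[OF this] show ?thesis by (auto simp: sv_dom_def)
  qed
  ultimately show "firm_growth_on_conjugate_dom J" by (simp add: firm_growth_on_conjugate_dom_def)
qed

section \<open>Moduli of firm subdifferentiability\<close>

text \<open>The supremum of the functions \<open>max 0 (\<delta> (t - \<epsilon>))\<close> over all \<open>\<epsilon> > 0\<close> is convex and lower
  semicontinuous, and it is positive at \<open>t > 0\<close> because of the member with \<open>\<epsilon> = t / 2\<close>.\<close>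
lemma Gamma0_modulus_if_firm_growth:
  assumes firm: "firm_growth J x f"
  shows "\<exists>\<psi>\<in>Gamma0. firm_subgradient_ineq J x f \<psi>"
proof -
  obtain r where r: "J x = ereal r" using firm_growth_finite[OF firm] .
  have "\<forall>\<epsilon>>0. \<exists>\<delta>>0. \<forall>u a. J u \<le> ereal a \<longrightarrow>
      r + blinfun_apply f (u - x) + \<delta> * (norm (u - x) - \<epsilon>) \<le> a"
    using firm by (simp add: firm_growth_def r)
  then have "\<forall>\<epsilon>\<in>{0<..}. \<exists>\<delta>>0. \<forall>u a. J u \<le> ereal a \<longrightarrow>
      r + blinfun_apply f (u - x) + \<delta> * (norm (u - x) - \<epsilon>) \<le> a" by simp
  from bchoice[OF this] obtain \<delta> where *: "\<forall>\<epsilon>\<in>{0<..}. 0 < \<delta> \<epsilon> \<and> (\<forall>u a. J u \<le> ereal a \<longrightarrow>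
      r + blinfun_apply f (u - x) + \<delta> \<epsilon> * (norm (u - x) - \<epsilon>) \<le> a)" ..
  then have \<delta>: "\<And>\<epsilon>. 0 < \<epsilon> \<Longrightarrow> 0 < \<delta> \<epsilon>" by simp
  from * have growth: "\<And>\<epsilon> u a. 0 < \<epsilon> \<Longrightarrow> J u \<le> ereal a \<Longrightarrow>
      r + blinfun_apply f (u - x) + \<delta> \<epsilon> * (norm (u - x) - \<epsilon>) \<le> a" by simp
  define \<phi> where "\<phi> = (\<lambda>\<epsilon> t. max 0 (\<delta> \<epsilon> * (t - \<epsilon>)))"
  define \<psi> where "\<psi> = (\<lambda>t. SUP \<epsilon>\<in>{0<..}. ereal (\<phi> \<epsilon> t))"
  have le_\<psi>: "ereal (\<phi> \<epsilon> t) \<le> \<psi> t" if "0 < \<epsilon>" for \<epsilon> t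
    unfolding \<psi>_def using that by (intro SUP_upper) simp
  have nonneg: "0 \<le> \<psi> t" for t
  proof -
    have "ereal 0 \<le> ereal (\<phi> 1 t)" by (simp add: \<phi>_def)
    also have "\<dots> \<le> \<psi> t" by (rule le_\<psi>) simp
    finally show ?thesis by (simp add: zero_ereal_def)
  qed
  have "lsc_on {0..} \<psi>"
    unfolding lsc_on_def le_Liminf_iff
  proof (intro ballI allI impI)
    fix t y assume "y < \<psi> t"
    then obtain \<epsilon> where \<epsilon>: "0 < \<epsilon>" "y < ereal (\<phi> \<epsilon> t)" by (auto simp: \<psi>_def less_SUP_iff)
    have "((\<lambda>t. ereal (\<phi> \<epsilon> t)) \<longlongrightarrow> ereal (\<phi> \<epsilon> t)) (at t within {0..})"
      unfolding \<phi>_def by (intro tendsto_intros)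
    then have "\<forall>\<^sub>F z in at t within {0..}. y < ereal (\<phi> \<epsilon> z)" using \<epsilon>(2) by (rule order_tendstoD(1))
    then show "\<forall>\<^sub>F z in at t within {0..}. y < \<psi> z"
      by eventually_elim (use le_\<psi>[OF \<epsilon>(1)] less_le_trans in blast)
  qed
  moreover have "ereal_convex_on {0..} \<psi>"
    unfolding ereal_convex_on_def
  proof (intro conjI ballI allI impI)
    fix p q t :: real assume t: "0 < t \<and> t < 1"
    show "\<psi> ((1 - t) *\<^sub>R p + t *\<^sub>R q) \<le> ereal (1 - t) * \<psi> p + ereal t * \<psi> q"
    proof (subst \<psi>_def, rule SUP_least)
      fix \<epsilon> :: real assume "\<epsilon> \<in> {0<..}"
      then have \<epsilon>: "0 < \<epsilon>" by simp
      have "(1 - t) * (\<delta> \<epsilon> * (p - \<epsilon>)) \<le> (1 - t) * \<phi> \<epsilon> p" "t * (\<delta> \<epsilon> * (q - \<epsilon>)) \<le> t * \<phi> \<epsilon> q"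
        "0 \<le> (1 - t) * \<phi> \<epsilon> p" "0 \<le> t * \<phi> \<epsilon> q"
        using t by (auto simp: \<phi>_def intro!: mult_left_mono)
      moreover have "\<delta> \<epsilon> * ((1 - t) * p + t * q - \<epsilon>)
          = (1 - t) * (\<delta> \<epsilon> * (p - \<epsilon>)) + t * (\<delta> \<epsilon> * (q - \<epsilon>))"
        by (simp add: algebra_simps)
      ultimately have "\<phi> \<epsilon> ((1 - t) *\<^sub>R p + t *\<^sub>R q) \<le> (1 - t) * \<phi> \<epsilon> p + t * \<phi> \<epsilon> q"
        by (subst \<phi>_def) simp
      then have "ereal (\<phi> \<epsilon> ((1 - t) *\<^sub>R p + t *\<^sub>R q)) \<le> ereal (1 - t) * ereal (\<phi> \<epsilon> p) + ereal t * ereal (\<phi> \<epsilon> q)"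
        by simp
      also have "\<dots> \<le> ereal (1 - t) * \<psi> p + ereal t * \<psi> q"
        using t le_\<psi>[OF \<epsilon>] by (intro add_mono ereal_mult_left_mono) auto
      finally show "ereal (\<phi> \<epsilon> ((1 - t) *\<^sub>R p + t *\<^sub>R q)) \<le> ereal (1 - t) * \<psi> p + ereal t * \<psi> q" .
    qed
  qed simp
  moreover have "\<psi> t = 0 \<longleftrightarrow> t = 0" if t: "0 \<le> t" for t
  proof
    assume "t = 0"
    have "\<psi> t \<le> 0"
      unfolding \<psi>_def
    proof (rule SUP_least)
      fix \<epsilon> :: real assume "\<epsilon> \<in> {0<..}"
      then have "\<phi> \<epsilon> t = 0" using \<delta>[of \<epsilon>] by (simp add: \<phi>_def \<open>t = 0\<close>)
      then show "ereal (\<phi> \<epsilon> t) \<le> 0" by (simp add: zero_ereal_def)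
    qed
    then show "\<psi> t = 0" using nonneg by (rule antisym)
  next
    assume \<psi>: "\<psi> t = 0"
    show "t = 0"
    proof (rule ccontr)
      assume "t \<noteq> 0"
      with t have "0 < t / 2" by simp
      then have "0 < \<phi> (t / 2) t" using \<delta>[of "t / 2"] by (simp add: \<phi>_def)
      moreover have "ereal (\<phi> (t / 2) t) \<le> 0" using le_\<psi>[OF \<open>0 < t / 2\<close>, of t] \<psi> by simp
      ultimately show False by (simp add: zero_ereal_def)
    qed
  qed
  ultimately have "\<psi> \<in> Gamma0" using nonneg by (simp add: Gamma0_def)
  moreover have "firm_subgradient_ineq J x f \<psi>"
    unfolding firm_subgradient_ineq_def
  proof (rule allI, rule ereal_le_real)
    fix u a assume u: "J u \<le> ereal a"
    have "\<psi> (norm (u - x)) \<le> ereal (a - (r + blinfun_apply f (u - x)))"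
      unfolding \<psi>_def
    proof (rule SUP_least)
      fix \<epsilon> :: real assume "\<epsilon> \<in> {0<..}"
      then have "r + blinfun_apply f (u - x) + \<delta> \<epsilon> * (norm (u - x) - \<epsilon>) \<le> a"
        using growth u by simp
      moreover have "r + blinfun_apply f (u - x) \<le> a"
        using subdiff_if_firm_growth[OF firm] r u by (auto simp: subdiff_iff)
      ultimately show "ereal (\<phi> \<epsilon> (norm (u - x))) \<le> ereal (a - (r + blinfun_apply f (u - x)))"
        by (simp add: \<phi>_def)
    qed
    then have "ereal (r + blinfun_apply f (u - x)) + \<psi> (norm (u - x))
        \<le> ereal (r + blinfun_apply f (u - x)) + ereal (a - (r + blinfun_apply f (u - x)))"
      by (rule add_left_mono)
    then show "J x + ereal (blinfun_apply f (u - x)) + \<psi> (norm (u - x)) \<le> ereal a"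
      by (simp add: r)
  qed
  ultimately show ?thesis by blast
qed

text \<open>Convexity and \<open>\<psi> 0 = 0\<close> give \<open>\<psi> t \<ge> (t / \<epsilon>) \<psi> \<epsilon>\<close> for \<open>t \<ge> \<epsilon>\<close>; a positive real number below
  \<open>\<psi> \<epsilon>\<close> is used because \<open>\<psi> \<epsilon>\<close> may be infinite.\<close>
lemma firm_growth_if_Gamma0_modulus:
  assumes f: "f \<in> subdiff J x" and \<psi>: "\<psi> \<in> Gamma0" and ineq: "firm_subgradient_ineq J x f \<psi>"
  shows "firm_growth J x f"
proof -
  obtain r where r: "J x = ereal r"
    and sub: "\<And>u a. J u \<le> ereal a \<Longrightarrow> r + blinfun_apply f (u - x) \<le> a" using f by (auto simp: subdiff_iff)
  have \<psi>0: "\<psi> 0 = 0" and pos: "\<And>t. 0 < t \<Longrightarrow> 0 < \<psi> t" and convex: "ereal_convex_on {0..} \<psi>"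
    using \<psi> by (auto simp: Gamma0_def less_le)
  have "\<exists>\<delta>>0. \<forall>u a. J u \<le> ereal a \<longrightarrow> r + blinfun_apply f (u - x) + \<delta> * (norm (u - x) - \<epsilon>) \<le> a"
    if \<epsilon>: "0 < \<epsilon>" for \<epsilon>
  proof -
    obtain \<eta> where \<eta>: "0 < ereal \<eta>" "ereal \<eta> < \<psi> \<epsilon>" using ereal_dense2[OF pos[OF \<epsilon>]] by blast
    have "r + blinfun_apply f (u - x) + \<eta> / \<epsilon> * (norm (u - x) - \<epsilon>) \<le> a" if u: "J u \<le> ereal a" for u a
    proof (cases "norm (u - x) \<le> \<epsilon>")
      case True
      then have "\<eta> / \<epsilon> * (norm (u - x) - \<epsilon>) \<le> 0" using \<eta> \<epsilon> by (intro mult_nonneg_nonpos) auto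
      then show ?thesis using sub[OF u] by simp
    next
      case False
      define t where "t = norm (u - x)"
      define s where "s = \<epsilon> / t"
      define b where "b = a - (r + blinfun_apply f (u - x))"
      have t: "\<epsilon> < t" using False by (simp add: t_def)
      with \<epsilon> have "0 < t" by simp
      with t have t: "\<epsilon> < t" "0 < t" and s: "0 < s" "s < 1" using \<epsilon> by (auto simp: s_def)
      have "ereal (r + blinfun_apply f (u - x)) + \<psi> t \<le> J u"
        using ineq r unfolding firm_subgradient_ineq_def t_def by (metis plus_ereal.simps(1))
      also have "\<dots> \<le> ereal a" by (rule u)
      finally have "\<psi> t \<le> ereal b" by (cases "\<psi> t") (auto simp: b_def)
      have "\<psi> ((1 - s) *\<^sub>R 0 + s *\<^sub>R t) \<le> ereal (1 - s) * \<psi> 0 + ereal s * \<psi> t"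
        using convex t s unfolding ereal_convex_on_def by (metis atLeast_iff less_imp_le order_refl)
      moreover have "(1 - s) *\<^sub>R 0 + s *\<^sub>R t = \<epsilon>" using t by (simp add: s_def)
      ultimately have "\<psi> \<epsilon> \<le> ereal s * \<psi> t" by (simp add: \<psi>0)
      also have "\<dots> \<le> ereal s * ereal b" using \<open>\<psi> t \<le> ereal b\<close> s by (intro ereal_mult_left_mono) auto
      finally have "\<psi> \<epsilon> \<le> ereal (s * b)" by simp
      with \<eta>(2) have "ereal \<eta> < ereal (s * b)" by (rule less_le_trans)
      then have "\<eta> < s * b" by simp
      then have "\<eta> * t < \<epsilon> * b" using t by (simp add: s_def field_simps)
      then have "\<eta> / \<epsilon> * t < b" using \<epsilon> by (simp add: field_simps)
      moreover have "0 < \<eta>" using \<eta> by simp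
      ultimately have "\<eta> / \<epsilon> * (t - \<epsilon>) \<le> b" using \<epsilon> by (simp add: right_diff_distrib)
      then show ?thesis by (simp add: t_def b_def)
    qed
    then show ?thesis using \<eta> \<epsilon> by (intro exI[of _ "\<eta> / \<epsilon>"]) auto
  qed
  then show ?thesis unfolding firm_growth_def using r by blast
qed

theorem ess_firmly_subdifferentiable_iff:
  assumes proper: "proper_fun J"
  shows "ess_firmly_subdifferentiable J \<longleftrightarrow> firm_growth_on_subdiff J"
proof
  assume "ess_firmly_subdifferentiable J"
  then have "ereal_convex_on UNIV J" and firm: "\<forall>x\<in>sv_dom (subdiff J). \<forall>f\<in>subdiff J x.
      \<exists>\<psi>\<in>Gamma0. firm_subgradient_ineq J x f \<psi>"
    by (simp_all add: ess_firmly_subdifferentiable_def)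
  moreover have "firm_growth J x f" if f: "f \<in> subdiff J x" for x f
  proof -
    have "x \<in> sv_dom (subdiff J)" using f by (auto simp: sv_dom_def)
    then show ?thesis using firm f firm_growth_if_Gamma0_modulus[OF f] by blast
  qed
  ultimately show "firm_growth_on_subdiff J"
    using convex_epigraph_if_convex by (simp add: firm_growth_on_subdiff_def)
next
  assume "firm_growth_on_subdiff J"
  then have "convex (epi J)" and "\<And>x f. f \<in> subdiff J x \<Longrightarrow> \<exists>\<psi>\<in>Gamma0. firm_subgradient_ineq J x f \<psi>"
    using Gamma0_modulus_if_firm_growth unfolding firm_growth_on_subdiff_def by blast+
  moreover from this have "ereal_convex_on UNIV J"
    using proper by (intro convex_if_convex_epigraph) (simp_all add: proper_fun_def)
  ultimately show "ess_firmly_subdifferentiable J"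
    using proper unfolding ess_firmly_subdifferentiable_def by blast
qed

section \<open>Essential strong convexity\<close>

text \<open>If \<open>g\<close> is close to \<open>f\<close>, a minimiser of \<open>J - g\<close> cannot lie where \<open>J - f\<close> already grows at
  twice the rate \<open>|g - f|\<close>.\<close>
lemma locally_bounded_inverse_if_firm_growth:
  assumes J: "firm_growth_on_subdiff J"
  shows "sv_locally_bounded_on_dom (sv_inverse (subdiff J))"
  unfolding sv_locally_bounded_on_dom_def
proof
  fix f assume "f \<in> sv_dom (sv_inverse (subdiff J))"
  then obtain x where f: "f \<in> subdiff J x" by (auto simp: sv_dom_def sv_inverse_def)
  then have firm: "firm_growth J x f" using J by (auto simp: firm_growth_on_subdiff_def)
  obtain r where r: "J x = ereal r" using firm_growth_finite[OF firm] .
  obtain \<delta> where \<delta>: "0 < \<delta>"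
    and growth: "\<And>u a. J u \<le> ereal a \<Longrightarrow> r + blinfun_apply f (u - x) + \<delta> * (norm (u - x) - 1) \<le> a"
    using firm_growthD[OF firm r, of 1] by auto
  have "norm (y - x) \<le> 2" if g: "g \<in> ball f (\<delta> / 2)" "g \<in> subdiff J y" for g y
  proof -
    obtain s where s: "J y = ereal s" and "s + blinfun_apply g (x - y) \<le> r"
      using g(2) r by (auto simp: subdiff_iff)
    moreover have "r + blinfun_apply f (y - x) + \<delta> * (norm (y - x) - 1) \<le> s"
      using growth s by simp
    moreover have "blinfun_apply (g - f) (y - x) \<le> norm (g - f) * norm (y - x)"
      using norm_blinfun[of "g - f" "y - x"] by simp
    moreover have "norm (g - f) * norm (y - x) \<le> \<delta> / 2 * norm (y - x)"
      using g(1) by (intro mult_right_mono) (auto simp: dist_norm norm_minus_commute)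
    ultimately have "\<delta> * (norm (y - x) - 1) \<le> \<delta> / 2 * norm (y - x)"
      by (simp add: blinfun.diff_left blinfun.diff_right)
    then have "\<delta> * norm (y - x) \<le> \<delta> * 2" by (simp add: algebra_simps)
    then show ?thesis using \<delta> by simp
  qed
  then have "(\<Union>g\<in>ball f (\<delta> / 2). sv_inverse (subdiff J) g) \<subseteq> cball x 2"
    by (auto simp: sv_inverse_def dist_norm norm_minus_commute)
  then have "bounded (\<Union>g\<in>ball f (\<delta> / 2). sv_inverse (subdiff J) g)"
    by (rule bounded_subset[OF bounded_cball])
  then show "\<exists>V. open V \<and> f \<in> V \<and> bounded (\<Union>v\<in>V. sv_inverse (subdiff J) v)"
    using \<delta> by (intro exI[of _ "ball f (\<delta> / 2)"]) auto
qed

text \<open>A subgradient at the intermediate point \<open>m\<close> gives an affine function that is strictly below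
  \<open>J\<close> at \<open>x\<close> by firm growth.\<close>
lemma strictly_convex_if_firm_growth:
  assumes J: "firm_growth_on_subdiff J" and C: "C \<subseteq> sv_dom (subdiff J)" "convex C"
  shows "ereal_strictly_convex_on C J"
  unfolding ereal_strictly_convex_on_def
proof (intro conjI C(2) ballI allI impI)
  fix x y and t :: real
  assume x: "x \<in> C" and y: "y \<in> C" and "x \<noteq> y \<and> 0 < t \<and> t < 1"
  then have t: "0 < t" "t < 1" and xy: "x \<noteq> y" by auto
  define m where "m = (1 - t) *\<^sub>R x + t *\<^sub>R y"
  have fin: "\<exists>a. J z = ereal a" if "z \<in> C" for z
    using that C(1) by (auto simp: sv_dom_def subdiff_iff)
  obtain a b where ab: "J x = ereal a" "J y = ereal b" using fin x y by blast
  have "m \<in> C" unfolding m_def using C(2) x y t by (intro convexD_alt) auto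
  then obtain f where f: "f \<in> subdiff J m" using C(1) by (auto simp: sv_dom_def)
  then have firm: "firm_growth J m f" using J by (auto simp: firm_growth_on_subdiff_def)
  obtain r where r: "J m = ereal r" using firm_growth_finite[OF firm] .
  have "x - m = t *\<^sub>R (x - y)" by (simp add: m_def algebra_simps)
  then have \<epsilon>: "0 < norm (x - m) / 2" using t xy by simp
  then obtain \<delta> where \<delta>: "0 < \<delta>" and growth: "\<And>u a. J u \<le> ereal a \<Longrightarrow>
      r + blinfun_apply f (u - m) + \<delta> * (norm (u - m) - norm (x - m) / 2) \<le> a"
    using firm_growthD[OF firm r] by metis
  have "0 < \<delta> * (norm (x - m) / 2)" using \<delta> \<epsilon> by simp
  then have 1: "r + blinfun_apply f (x - m) < a" using growth[of x a] ab by simp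
  have 2: "r + blinfun_apply f (y - m) \<le> b" using f ab r by (auto simp: subdiff_iff)
  have "(1 - t) * (r + blinfun_apply f (x - m)) + t * (r + blinfun_apply f (y - m)) < (1 - t) * a + t * b"
    using 1 2 t by (intro add_less_le_mono mult_strict_left_mono mult_left_mono) auto
  moreover have "(1 - t) * (r + blinfun_apply f (x - m)) + t * (r + blinfun_apply f (y - m)) = r"
    by (simp add: m_def blinfun.add_right blinfun.diff_right blinfun.scaleR_right algebra_simps)
  ultimately show "J ((1 - t) *\<^sub>R x + t *\<^sub>R y) < ereal (1 - t) * J x + ereal t * J y"
    using r by (simp add: ab m_def)
qed

lemma ess_strongly_convex_if_firm_growth:
  assumes proper: "proper_fun J" and closed: "closed (epi J)" and J: "firm_growth_on_subdiff J"
  shows "ess_strongly_convex J"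
proof -
  have "Gamma_fun J" using assms by (simp add: Gamma_fun_iff firm_growth_on_subdiff_def)
  moreover have "\<exists>f\<in>subdiff J x. \<exists>\<psi>\<in>Gamma0. firm_subgradient_ineq J x f \<psi>"
    if x: "x \<in> sv_dom (subdiff J)" for x
  proof -
    obtain f where "f \<in> subdiff J x" using x by (auto simp: sv_dom_def)
    then show ?thesis using J Gamma0_modulus_if_firm_growth unfolding firm_growth_on_subdiff_def by blast
  qed
  ultimately show ?thesis
    using locally_bounded_inverse_if_firm_growth[OF J] strictly_convex_if_firm_growth[OF J]
    by (simp add: ess_strongly_convex_def ess_strictly_convex_def)
qed

text \<open>For \<open>g\<close> close to \<open>f\<close>, let \<open>h\<close> be an Ekeland point of \<open>v \<mapsto> G v + L |v - g|\<close> with \<open>L\<close> larger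
  than the bound \<open>R\<close> on the subgradients. It stays in \<open>V\<close>. If \<open>h \<noteq> g\<close>, the penalty would force a
  subgradient at \<open>h\<close> of norm at least \<open>L - 1 > R\<close>; so \<open>h = g\<close>, and \<open>G\<close> has a subgradient at \<open>g\<close>.\<close>
theorem interior_if_subdiff_locally_bounded:
  fixes G :: "'a::banach \<Rightarrow> ereal"
  assumes Gamma: "Gamma_fun G" and f: "f \<in> sv_dom (subdiff G)"
    and V: "open V" "f \<in> V" and bound: "\<And>h k. h \<in> V \<Longrightarrow> k \<in> subdiff G h \<Longrightarrow> norm k \<le> R"
  shows "f \<in> interior (sv_dom (subdiff G))"
proof -
  have closed: "closed (epi G)" and convex: "convex (epi G)" using Gamma by (auto simp: Gamma_fun_iff)
  obtain k0 where k0: "k0 \<in> subdiff G f" using f by (auto simp: sv_dom_def)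
  then obtain s where s: "G f = ereal s"
    and k0_le: "\<And>v a. G v \<le> ereal a \<Longrightarrow> s + blinfun_apply k0 (v - f) \<le> a" by (auto simp: subdiff_iff)
  have k0_norm: "norm k0 \<le> R" using bound V k0 by blast
  then have R: "0 \<le> R" using norm_ge_zero order_trans by blast
  have lower: "s - R * norm (v - f) \<le> a" if v: "G v \<le> ereal a" for v a
  proof -
    have "- blinfun_apply k0 (v - f) \<le> norm k0 * norm (v - f)" using norm_blinfun[of k0 "v - f"] by simp
    moreover have "norm k0 * norm (v - f) \<le> R * norm (v - f)" using k0_norm by (rule mult_right_mono) simp
    ultimately show ?thesis using k0_le[OF v] by linarith
  qed
  obtain e where e: "0 < e" "ball f e \<subseteq> V" using V openE by blast
  \<comment> \<open>Any slope exceeding \<open>R\<close> by more than the Ekeland constant 1 will do.\<close>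
  define L where "L = 2 * R + 2"
  have "g \<in> sv_dom (subdiff G)" if g: "norm (g - f) < e / 4" for g
  proof -
    define E where "E = {p. (fst p, snd p - L * norm (fst p - g)) \<in> epi G}"
    have E: "(v, b) \<in> E \<longleftrightarrow> G v \<le> ereal (b - L * norm (v - g))" for v b by (simp add: E_def)
    have "closed ((\<lambda>p. (fst p, snd p - L * norm (fst p - g))) -` epi G)"
      by (intro closed_vimage closed continuous_intros)
    then have "closed E" by (simp add: E_def vimage_def)
    moreover have "s - R * norm (g - f) \<le> b" if "(v, b) \<in> E" for v b
    proof -
      have "R * norm (v - f) \<le> R * (norm (v - g) + norm (g - f))"
        using R norm_triangle_ineq[of "v - g" "g - f"] by (intro mult_left_mono) auto
      moreover have "R * norm (v - g) \<le> L * norm (v - g)"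
        using R by (intro mult_right_mono) (auto simp: L_def)
      ultimately show ?thesis using lower[of v "b - L * norm (v - g)"] that
        unfolding E distrib_left by linarith
    qed
    moreover have "(f, s + L * norm (f - g)) \<in> E" by (simp add: E s)
    ultimately obtain h d where h: "(h, d) \<in> E"
      and start: "d + 1 * dist h f \<le> s + L * norm (f - g)"
      and ekeland: "\<And>v b. (v, b) \<in> E \<Longrightarrow> d - 1 * dist v h \<le> b"
      using Ekeland_set[of E "s - R * norm (g - f)" f "s + L * norm (f - g)" 1] zero_less_one by blast
    define c where "c = d - L * norm (h - g)"
    have hc: "G h \<le> ereal c" using h by (simp add: E c_def)
    have min: "d - norm (v - h) \<le> a + L * norm (v - g)" if "G v \<le> ereal a" for v a
      using ekeland[of v "a + L * norm (v - g)"] that by (simp add: E dist_norm)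
    \<comment> \<open>The penalty keeps \<open>h\<close> within distance \<open>4 |f - g|\<close> of \<open>f\<close>.\<close>
    have "h \<in> V"
    proof -
      have "L * norm (h - f) \<le> L * (norm (h - g) + norm (f - g))"
        using R norm_triangle_ineq[of "h - g" "g - f"]
        by (intro mult_left_mono) (auto simp: L_def norm_minus_commute)
      moreover have "s - R * norm (h - f) \<le> c" by (rule lower[OF hc])
      moreover have "d \<le> s + L * norm (f - g)" using start zero_le_dist[of h f] by linarith
      ultimately have "(L - R) * norm (h - f) \<le> 2 * L * norm (f - g)"
        by (simp add: c_def algebra_simps)
      moreover have "2 * L * norm (f - g) \<le> (L - R) * (4 * norm (f - g))"
        using R mult_nonneg_nonneg[of R "norm (f - g)"] by (simp add: L_def algebra_simps)
      ultimately have "(L - R) * norm (h - f) \<le> (L - R) * (4 * norm (f - g))" by linarith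
      then have "norm (h - f) \<le> 4 * norm (f - g)" using R by (simp add: L_def)
      then have "h \<in> ball f e" using g by (simp add: dist_norm norm_minus_commute)
      then show ?thesis using e by blast
    qed
    \<comment> \<open>The sum rule for \<open>G\<close> and the Lipschitz function \<open>L |y - g| + |y - h|\<close>: separate the two graphs.\<close>
    define E2 where "E2 = {(v - y, b) | v y b. \<exists>a. G v \<le> ereal a \<and>
        a + L * norm (y - g) + norm (y - h) - d \<le> b}"
    have E2I: "(v - y, a + L * norm (y - g) + norm (y - h) - d) \<in> E2" if "G v \<le> ereal a" for v y a
      using that by (auto simp: E2_def)
    have "convex E2"
    proof (rule convexI)
      fix p q and \<sigma> \<tau> :: real
      assume "p \<in> E2" "q \<in> E2" and st: "0 \<le> \<sigma>" "0 \<le> \<tau>" "\<sigma> + \<tau> = 1"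
      then obtain v y b a v' y' b' a' where p: "p = (v - y, b)" "G v \<le> ereal a"
          "a + L * norm (y - g) + norm (y - h) - d \<le> b"
        and q: "q = (v' - y', b')" "G v' \<le> ereal a'"
          "a' + L * norm (y' - g) + norm (y' - h) - d \<le> b'" by (auto simp: E2_def)
      have \<sigma>: "\<sigma> = 1 - \<tau>" using st by simp
      have G: "G (\<sigma> *\<^sub>R v + \<tau> *\<^sub>R v') \<le> ereal (\<sigma> * a + \<tau> * a')"
        unfolding \<sigma> using st by (intro convex_epigraphD[OF convex p(2) q(2)]) auto
      have norm: "norm (\<sigma> *\<^sub>R y + \<tau> *\<^sub>R y' - z) \<le> \<sigma> * norm (y - z) + \<tau> * norm (y' - z)" for z
      proof -
        have "\<sigma> *\<^sub>R y + \<tau> *\<^sub>R y' - z = \<sigma> *\<^sub>R (y - z) + \<tau> *\<^sub>R (y' - z)" by (simp add: \<sigma> algebra_simps)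
        then show ?thesis using st norm_triangle_ineq[of "\<sigma> *\<^sub>R (y - z)" "\<tau> *\<^sub>R (y' - z)"] by simp
      qed
      have "\<sigma> * (a + L * norm (y - g) + norm (y - h) - d) \<le> \<sigma> * b"
        "\<tau> * (a' + L * norm (y' - g) + norm (y' - h) - d) \<le> \<tau> * b'"
        using p q st by (auto intro!: mult_left_mono)
      moreover have "L * norm (\<sigma> *\<^sub>R y + \<tau> *\<^sub>R y' - g) \<le> L * (\<sigma> * norm (y - g) + \<tau> * norm (y' - g))"
        using R norm by (intro mult_left_mono) (auto simp: L_def)
      moreover have "\<sigma> * d + \<tau> * d = d" using st by (simp flip: distrib_right)
      ultimately have "\<sigma> * a + \<tau> * a' + L * norm (\<sigma> *\<^sub>R y + \<tau> *\<^sub>R y' - g)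
          + norm (\<sigma> *\<^sub>R y + \<tau> *\<^sub>R y' - h) - d \<le> \<sigma> * b + \<tau> * b'"
        using norm[of h] by (simp add: distrib_left right_diff_distrib mult.left_commute)
      moreover have "\<sigma> *\<^sub>R p + \<tau> *\<^sub>R q = ((\<sigma> *\<^sub>R v + \<tau> *\<^sub>R v') - (\<sigma> *\<^sub>R y + \<tau> *\<^sub>R y'), \<sigma> * b + \<tau> * b')"
        by (simp add: p q scaleR_diff_right)
      ultimately show "\<sigma> *\<^sub>R p + \<tau> *\<^sub>R q \<in> E2" using G unfolding E2_def by blast
    qed
    moreover have "- (L + 1) * norm z \<le> b" if "(z, b) \<in> E2" for z b
    proof -
      obtain v y a where z: "z = v - y" and v: "G v \<le> ereal a"
        and b: "a + L * norm (y - g) + norm (y - h) - d \<le> b" using \<open>(z, b) \<in> E2\<close> by (auto simp: E2_def)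
      have "L * norm (v - g) \<le> L * (norm (v - y) + norm (y - g))"
        using R norm_triangle_ineq[of "v - y" "y - g"] by (intro mult_left_mono) (auto simp: L_def)
      moreover have "norm (v - h) \<le> norm (v - y) + norm (y - h)"
        using norm_triangle_ineq[of "v - y" "y - h"] by simp
      ultimately show ?thesis using min[OF v] b by (simp add: z algebra_simps)
    qed
    ultimately have "\<exists>k :: 'a \<Rightarrow>\<^sub>L real. norm k \<le> L + 1 \<and>
        (\<forall>z b. (z, b) \<in> E2 \<longrightarrow> blinfun_apply k z \<le> b)"
      using R by (intro Hahn_Banach_convex_set) (auto simp: L_def)
    then obtain k :: "'a \<Rightarrow>\<^sub>L real" where "\<And>z b. (z, b) \<in> E2 \<Longrightarrow> blinfun_apply k z \<le> b" by blast
    then have k: "blinfun_apply k (v - y) \<le> a + L * norm (y - g) + norm (y - h) - d"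
      if "G v \<le> ereal a" for v y a using E2I[OF that] by blast
    have k_sub: "c + blinfun_apply k (v - h) \<le> a" if "G v \<le> ereal a" for v a
      using k[OF that, of h] by (simp add: c_def)
    have "ereal c \<le> G h"
      using k_sub[of h] by (simp add: ereal_le_iff_epigraph blinfun.zero_right)
    with hc have "G h = ereal c" by (rule antisym)
    with k_sub have sub: "k \<in> subdiff G h" by (auto simp: subdiff_iff)
    have "blinfun_apply k (h - g) \<le> c + norm (h - g) - d" using k[OF hc, of g] by (simp add: norm_minus_commute)
    moreover have "- blinfun_apply k (h - g) \<le> norm k * norm (h - g)" using norm_blinfun[of k "h - g"] by simp
    moreover have "norm k * norm (h - g) \<le> R * norm (h - g)"
      using bound[OF \<open>h \<in> V\<close> sub] by (rule mult_right_mono) simp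
    ultimately have "(L - 1 - R) * norm (h - g) \<le> 0" by (simp add: c_def algebra_simps)
    then have "norm (h - g) = 0" using R by (simp add: L_def mult_le_0_iff)
    then show ?thesis using sub by (auto simp: sv_dom_def)
  qed
  then have "ball f (e / 4) \<subseteq> sv_dom (subdiff G)" by (auto simp: dist_norm norm_minus_commute)
  then show ?thesis using e mem_interior[of f "sv_dom (subdiff G)"] by (metis zero_less_divide_iff zero_less_numeral)
qed

text \<open>If \<open>G\<close> grew at a rate of at least \<open>\<kappa>\<close> in the direction \<open>g\<close>, then subgradients at nearby
  points \<open>f + t g\<close>, which are bounded by \<open>R\<close>, would show that the epigraph of \<open>G\<close> with the ray of
  slope \<open>\<kappa>\<close> subtracted lies above a cone; separation then gives a subgradient \<open>k\<close> at \<open>f\<close> with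
  \<open>k g \<ge> \<kappa>\<close>.\<close>
lemma directional_upper_bound:
  fixes G :: "'a::banach \<Rightarrow> ereal"
  assumes Gamma: "Gamma_fun G" and s: "G f = ereal s" and f: "f \<in> sv_dom (subdiff G)"
    and V: "open V" "f \<in> V" and bound: "\<And>h k. h \<in> V \<Longrightarrow> k \<in> subdiff G h \<Longrightarrow> norm k \<le> R"
    and less: "\<And>k. k \<in> subdiff G f \<Longrightarrow> blinfun_apply k g < \<kappa>"
  shows "\<exists>t>0. G (f + t *\<^sub>R g) \<le> ereal (s + t * \<kappa>)"
proof (rule ccontr)
  assume contra: "\<not> ?thesis"
  have convex: "convex (epi G)" using Gamma by (simp add: Gamma_fun_iff)
  have "f \<in> interior (sv_dom (subdiff G))" by (rule interior_if_subdiff_locally_bounded[OF Gamma f V bound])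
  then have "f \<in> V \<inter> interior (sv_dom (subdiff G))" using V by blast
  moreover have "open (V \<inter> interior (sv_dom (subdiff G)))" using V by blast
  ultimately obtain e where "0 < e" "ball f e \<subseteq> V \<inter> interior (sv_dom (subdiff G))"
    by (auto elim: openE)
  then have e: "0 < e" "ball f e \<subseteq> V \<inter> sv_dom (subdiff G)" using interior_subset by blast+
  obtain k0 where k0: "k0 \<in> subdiff G f" using f by (auto simp: sv_dom_def)
  have R: "0 \<le> R" using bound[OF V(2) k0] norm_ge_zero order_trans by blast
  have apply_ge: "- (R * norm v) \<le> blinfun_apply k v" if "norm k \<le> R" for k v
    using norm_blinfun[of k v] mult_right_mono[OF that, of "norm v"] by simp
  define E where "E = {(h - f - t *\<^sub>R g, a - s - t * \<kappa>) | h a t. G h \<le> ereal a \<and> 0 \<le> t}"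
  have "convex E"
  proof (rule convexI)
    fix p q and \<sigma> \<tau> :: real
    assume "p \<in> E" "q \<in> E" and st: "0 \<le> \<sigma>" "0 \<le> \<tau>" "\<sigma> + \<tau> = 1"
    then obtain h a t h' a' t' where p: "p = (h - f - t *\<^sub>R g, a - s - t * \<kappa>)" "G h \<le> ereal a" "0 \<le> t"
      and q: "q = (h' - f - t' *\<^sub>R g, a' - s - t' * \<kappa>)" "G h' \<le> ereal a'" "0 \<le> t'"
      by (auto simp: E_def)
    have \<sigma>: "\<sigma> = 1 - \<tau>" using st by simp
    have "G (\<sigma> *\<^sub>R h + \<tau> *\<^sub>R h') \<le> ereal (\<sigma> * a + \<tau> * a')"
      unfolding \<sigma> using st by (intro convex_epigraphD[OF convex p(2) q(2)]) auto
    moreover have "0 \<le> \<sigma> * t + \<tau> * t'" using st p q by simp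
    moreover have "\<sigma> *\<^sub>R p + \<tau> *\<^sub>R q = ((\<sigma> *\<^sub>R h + \<tau> *\<^sub>R h') - f - (\<sigma> * t + \<tau> * t') *\<^sub>R g,
        (\<sigma> * a + \<tau> * a') - s - (\<sigma> * t + \<tau> * t') * \<kappa>)"
      by (simp add: p q \<sigma> algebra_simps)
    ultimately show "\<sigma> *\<^sub>R p + \<tau> *\<^sub>R q \<in> E" unfolding E_def by blast
  qed
  moreover have "- R * norm z \<le> b" if "(z, b) \<in> E" for z b
  proof -
    obtain h a t where z: "z = h - f - t *\<^sub>R g" and b: "b = a - s - t * \<kappa>"
      and h: "G h \<le> ereal a" and t: "0 \<le> t" using \<open>(z, b) \<in> E\<close> by (auto simp: E_def)
    show ?thesis
    proof (cases "t = 0")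
      case True
      have "s + blinfun_apply k0 (h - f) \<le> a" using k0 h s by (auto simp: subdiff_iff)
      then show ?thesis using apply_ge[OF bound[OF V(2) k0], of "h - f"] by (simp add: z b True)
    next
      case False
      define t' where "t' = min t (e / (2 * (norm g + 1)))"
      have "0 < norm g + 1" using norm_ge_zero[of g] by linarith
      then have t': "0 < t'" "t' \<le> t" using False t e by (auto simp: t'_def)
      have "t' * norm g \<le> e / (2 * (norm g + 1)) * norm g" by (intro mult_right_mono) (auto simp: t'_def)
      also have "\<dots> < e"
        using e \<open>0 < norm g + 1\<close> mult_nonneg_nonneg[of e "norm g"] by (simp add: field_simps add_nonneg_pos)
      finally have "f + t' *\<^sub>R g \<in> ball f e" using t' by (simp add: dist_norm)
      then have "f + t' *\<^sub>R g \<in> V" "f + t' *\<^sub>R g \<in> sv_dom (subdiff G)" using e by auto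
      then obtain k where k: "k \<in> subdiff G (f + t' *\<^sub>R g)" and norm: "norm k \<le> R"
        using bound by (auto simp: sv_dom_def)
      obtain c where c: "G (f + t' *\<^sub>R g) = ereal c"
        and sub: "\<And>v a. G v \<le> ereal a \<Longrightarrow> c + blinfun_apply k (v - (f + t' *\<^sub>R g)) \<le> a"
        using k by (auto simp: subdiff_iff)
      have c_gr: "s + t' * \<kappa> < c" using contra t' c by (metis ereal_less_eq(3) not_less)
      have "c - t' * blinfun_apply k g \<le> s" using sub[of f s] s by (simp add: blinfun.minus_right blinfun.scaleR_right)
      then have "t' * \<kappa> \<le> t' * blinfun_apply k g" using c_gr by linarith
      then have "\<kappa> \<le> blinfun_apply k g" using t' by simp
      then have "(t - t') * \<kappa> \<le> (t - t') * blinfun_apply k g" using t' by (intro mult_left_mono) auto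
      moreover have "h - (f + t' *\<^sub>R g) = z + (t - t') *\<^sub>R g" by (simp add: z algebra_simps)
      then have "c + blinfun_apply k z + (t - t') * blinfun_apply k g \<le> a"
        using sub[OF h] by (simp add: blinfun.add_right blinfun.scaleR_right)
      ultimately show ?thesis using apply_ge[OF norm, of z] c_gr by (simp add: b left_diff_distrib)
    qed
  qed
  ultimately have "\<exists>k :: 'a \<Rightarrow>\<^sub>L real. norm k \<le> R \<and> (\<forall>z b. (z, b) \<in> E \<longrightarrow> blinfun_apply k z \<le> b)"
    by (intro Hahn_Banach_convex_set R)
  then obtain k :: "'a \<Rightarrow>\<^sub>L real" where kE: "\<And>z b. (z, b) \<in> E \<Longrightarrow> blinfun_apply k z \<le> b" by blast
  have k: "blinfun_apply k (h - f - t *\<^sub>R g) \<le> a - s - t * \<kappa>" if "G h \<le> ereal a" "0 \<le> t" for h a t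
    using that by (intro kE) (auto simp: E_def)
  have "s + blinfun_apply k (v - f) \<le> a" if "G v \<le> ereal a" for v a using k[OF that, of 0] by simp
  then have "k \<in> subdiff G f" using s by (auto simp: subdiff_iff)
  then have "blinfun_apply k g < \<kappa>" by (rule less)
  moreover have "\<kappa> \<le> blinfun_apply k g" using k[of f s 1] s by (simp add: blinfun.minus_right)
  ultimately show False by simp
qed

text \<open>The minimisers of \<open>J - f\<close> form a convex set on which \<open>J\<close> is affine.\<close>
lemma subdiff_inverse_singleton_if_ess_strictly_convex:
  assumes J: "ess_strictly_convex J" and x: "f \<in> subdiff J x" and y: "f \<in> subdiff J y"
  shows "y = x"
proof (rule ccontr)
  assume "y \<noteq> x"
  have Gamma: "Gamma_fun J" and strict: "\<And>C. C \<subseteq> sv_dom (subdiff J) \<Longrightarrow> convex C \<Longrightarrow> ereal_strictly_convex_on C J"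
    using J by (auto simp: ess_strictly_convex_def)
  have convex: "convex (epi J)" using Gamma by (simp add: Gamma_fun_iff)
  obtain r where r: "J x = ereal r" using x by (auto simp: subdiff_iff)
  define s where "s = blinfun_apply f x - r"
  have s: "conjugate J f = ereal s" unfolding s_def by (rule conjugate_eq_if_subdiff[OF x r])
  have ge: "ereal (blinfun_apply f u - s) \<le> J u" for u
    using Fenchel_Young[of J f s u] s by (simp add: ereal_le_iff_epigraph)
  have subI: "f \<in> subdiff J u" if "J u \<le> ereal (blinfun_apply f u - s)" for u
    using antisym[OF that ge] s by (intro subdiff_if_conjugate_le) auto
  have subD: "J u = ereal (blinfun_apply f u - s)" if u: "f \<in> subdiff J u" for u
  proof -
    obtain b where b: "J u = ereal b" using u by (auto simp: subdiff_iff)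
    then show ?thesis using conjugate_eq_if_subdiff[OF u b] s by simp
  qed
  define C where "C = {u. f \<in> subdiff J u}"
  have "convex C"
    unfolding convex_alt
  proof (intro ballI allI impI)
    fix u v and t :: real assume u: "u \<in> C" and v: "v \<in> C" and t: "0 \<le> t \<and> t \<le> 1"
    have "J ((1 - t) *\<^sub>R u + t *\<^sub>R v)
        \<le> ereal ((1 - t) * (blinfun_apply f u - s) + t * (blinfun_apply f v - s))"
      using t u v subD by (intro convex_epigraphD[OF convex]) (auto simp: C_def)
    also have "(1 - t) * (blinfun_apply f u - s) + t * (blinfun_apply f v - s)
        = blinfun_apply f ((1 - t) *\<^sub>R u + t *\<^sub>R v) - s"
      by (simp only: blinfun.add_right blinfun.scaleR_right) (simp add: algebra_simps)
    finally show "(1 - t) *\<^sub>R u + t *\<^sub>R v \<in> C" unfolding C_def by (simp add: subI)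
  qed
  then have "ereal_strictly_convex_on C J" by (intro strict) (auto simp: C_def sv_dom_def)
  moreover have "x \<in> C" "y \<in> C" using x y by (auto simp: C_def)
  ultimately have less: "x \<noteq> y \<and> 0 < t \<and> t < 1 \<longrightarrow>
      J ((1 - t) *\<^sub>R x + t *\<^sub>R y) < ereal (1 - t) * J x + ereal t * J y" for t
    unfolding ereal_strictly_convex_on_def by blast
  then have "J ((1 - 1/2) *\<^sub>R x + (1/2) *\<^sub>R y) < ereal (1 - 1/2) * J x + ereal (1/2) * J y"
    using less[of "1/2"] \<open>y \<noteq> x\<close> by simp
  moreover have "ereal (1 - 1/2) * J x + ereal (1/2) * J y
      = ereal (blinfun_apply f ((1 - 1/2) *\<^sub>R x + (1/2) *\<^sub>R y) - s)"
    using subD[OF x] subD[OF y] by (simp add: blinfun.add_right blinfun.scaleR_right field_simps)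
  ultimately show False using ge not_less by metis
qed

text \<open>With \<open>g = f - f0\<close> and \<open>b\<close> the excess of \<open>J u\<close> over its supporting affine function of slope
  \<open>f\<close>, the directional bound gives \<open>t g (u - x) - t \<delta> \<epsilon> / 2 \<le> b\<close> and the growth along \<open>f0\<close> gives
  \<open>\<delta> (|u - x| - \<epsilon> / 2) - g (u - x) \<le> b\<close>. Multiplying the second inequality by \<open>t\<close> and adding the
  first eliminates \<open>g (u - x)\<close>.\<close>
theorem firm_growth_if_ess_strongly_convex:
  fixes J :: "'a::banach \<Rightarrow> ereal"
  assumes refl: "reflexive_space TYPE('a)" and J: "ess_strongly_convex J"
  shows "firm_growth_on_subdiff J"
proof -
  have Gamma: "Gamma_fun J" and strict: "ess_strictly_convex J"
    and some: "\<And>x. x \<in> sv_dom (subdiff J) \<Longrightarrow>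
      \<exists>f\<in>subdiff J x. \<exists>\<psi>\<in>Gamma0. firm_subgradient_ineq J x f \<psi>"
    using J by (auto simp: ess_strongly_convex_def)
  have proper: "proper_fun J" and convex: "convex (epi J)" using Gamma by (auto simp: Gamma_fun_iff)
  let ?G = "conjugate J"
  have "firm_growth J x f" if f: "f \<in> subdiff J x" for x f
  proof -
    obtain r where r: "J x = ereal r" using f by (auto simp: subdiff_iff)
    have Gf: "?G f = ereal (blinfun_apply f x - r)" by (rule conjugate_eq_if_subdiff[OF f r])
    have "x \<in> sv_dom (subdiff J)" using f by (auto simp: sv_dom_def)
    then obtain f0 where f0: "f0 \<in> subdiff J x" and firm: "firm_growth J x f0"
      using some firm_growth_if_Gamma0_modulus by blast
    have dom: "f \<in> sv_dom (subdiff ?G)"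
      using subdiff_conjugate_if_subdiff[OF f] by (auto simp: sv_dom_def)
    then have GammaG: "Gamma_fun ?G" by (intro Gamma_fun_conjugate_if_sv_dom[OF proper]) auto
    have lift: "\<exists>y. k = eval_at y \<and> h \<in> subdiff J y" if k: "k \<in> subdiff ?G h" for h k
    proof -
      obtain y where "k = eval_at y" using reflexive_spaceE[OF refl] .
      then show ?thesis using subdiff_if_subdiff_conjugate[OF Gamma] k by blast
    qed
    have "f \<in> sv_dom (sv_inverse (subdiff J))" using f by (auto simp: sv_dom_def sv_inverse_def)
    then obtain V where V: "open V" "f \<in> V" and "bounded (\<Union>v\<in>V. sv_inverse (subdiff J) v)"
      using strict by (auto simp: ess_strictly_convex_def sv_locally_bounded_on_dom_def)
    then obtain R where R: "\<And>y. y \<in> (\<Union>v\<in>V. sv_inverse (subdiff J) v) \<Longrightarrow> norm y \<le> R"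
      by (auto simp: bounded_iff)
    have bound: "norm k \<le> R" if h: "h \<in> V" and k: "k \<in> subdiff ?G h" for h k
    proof -
      obtain y where y: "k = eval_at y" "h \<in> subdiff J y" using lift[OF k] by blast
      then have "norm y \<le> R" using h by (intro R) (auto simp: sv_inverse_def)
      then show ?thesis using norm_eval_at_le[of y] y by simp
    qed
    have unique: "k = eval_at x" if "k \<in> subdiff ?G f" for k
      using lift[OF that] subdiff_inverse_singleton_if_ess_strictly_convex[OF strict f] by blast
    have "\<exists>\<delta>>0. \<forall>u a. J u \<le> ereal a \<longrightarrow> r + blinfun_apply f (u - x) + \<delta> * (norm (u - x) - \<epsilon>) \<le> a"
      if \<epsilon>: "0 < \<epsilon>" for \<epsilon>
    proof -
      obtain \<delta> where \<delta>: "0 < \<delta>" and growth: "\<And>u a. J u \<le> ereal a \<Longrightarrow>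
          r + blinfun_apply f0 (u - x) + \<delta> * (norm (u - x) - \<epsilon> / 2) \<le> a"
        using firm_growthD[OF firm r, of "\<epsilon> / 2"] \<epsilon> by auto
      define g where "g = f - f0"
      have less: "blinfun_apply k g < blinfun_apply g x + \<delta> * (\<epsilon> / 2)" if "k \<in> subdiff ?G f" for k
        using unique[OF that] \<delta> \<epsilon> by simp
      have "\<exists>t>0. ?G (f + t *\<^sub>R g)
          \<le> ereal (blinfun_apply f x - r + t * (blinfun_apply g x + \<delta> * (\<epsilon> / 2)))"
      proof (rule directional_upper_bound[OF GammaG Gf dom V])
        show "norm k \<le> R" if "h \<in> V" "k \<in> subdiff ?G h" for h k using that by (rule bound)
      qed (rule less)
      then obtain t where t: "0 < t" and up: "?G (f + t *\<^sub>R g)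
          \<le> ereal (blinfun_apply f x - r + t * (blinfun_apply g x + \<delta> * (\<epsilon> / 2)))" by blast
      have "r + blinfun_apply f (u - x) + (t * \<delta> / (1 + t)) * (norm (u - x) - \<epsilon>) \<le> a"
        if u: "J u \<le> ereal a" for u a
      proof -
        define b where "b = a - (r + blinfun_apply f (u - x))"
        have "blinfun_apply (f + t *\<^sub>R g) u
            - (blinfun_apply f x - r + t * (blinfun_apply g x + \<delta> * (\<epsilon> / 2))) \<le> a"
          by (rule Fenchel_Young[OF up u])
        then have 1: "t * blinfun_apply g (u - x) - t * (\<delta> * (\<epsilon> / 2)) \<le> b"
          by (simp add: b_def blinfun.add_left blinfun.scaleR_left blinfun.diff_right algebra_simps)
        have "\<delta> * (norm (u - x) - \<epsilon> / 2) - blinfun_apply g (u - x) \<le> b"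
          using growth[OF u] by (simp add: b_def g_def blinfun.diff_left)
        then have "t * (\<delta> * (norm (u - x) - \<epsilon> / 2) - blinfun_apply g (u - x)) \<le> t * b"
          using t by (intro mult_left_mono) auto
        with 1 have "t * \<delta> * (norm (u - x) - \<epsilon>) \<le> (1 + t) * b" by (simp add: algebra_simps)
        then have "t * \<delta> * (norm (u - x) - \<epsilon>) / (1 + t) \<le> b" using t by (simp add: divide_le_eq mult.commute)
        then show ?thesis by (simp add: b_def)
      qed
      then show ?thesis using t \<delta> by (intro exI[of _ "t * \<delta> / (1 + t)"]) auto
    qed
    then show ?thesis using r unfolding firm_growth_def by blast
  qed
  then show ?thesis using convex by (simp add: firm_growth_on_subdiff_def)
qed

theorem proposition7:
  fixes H :: "'a::banach \<Rightarrow> ereal"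
  assumes "reflexive_space TYPE('a)"
    and "proper_fun H"
    and "lsc_on UNIV H"
  shows "(strongly_adequate H \<longleftrightarrow> ess_frechet_differentiable (conjugate H)) \<and>
         (ess_frechet_differentiable (conjugate H) \<longleftrightarrow> ess_firmly_subdifferentiable H) \<and>
         (ess_firmly_subdifferentiable H \<longleftrightarrow> ess_strongly_convex H)"
proof -
  have closed: "closed (epi H)" using assms(3) by (simp add: closed_epigraph_iff_lsc)
  have "ess_strongly_convex H \<longleftrightarrow> firm_growth_on_subdiff H"
    using ess_strongly_convex_if_firm_growth[OF assms(2) closed]
      firm_growth_if_ess_strongly_convex[OF assms(1)] by blast
  then show ?thesis
    using strongly_adequate_iff_firm_growth[OF assms(2)]
      ess_frechet_conjugate_iff_firm_growth[OF assms(1,2) closed]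
      firm_growth_on_subdiff_iff[OF assms(1,2) closed]
      ess_firmly_subdifferentiable_iff[OF assms(2)]
    by blast
qed

end
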